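(* Let $L_0>0$ and consider a spike and slab prior $\pi$ on $\ell^2(\Lambda)$ as defined in the context (with slab density $g$, weights $w_{j,n}$, and constants $L_0$, $K$, $\tau$). If $Y^n$ is drawn from the Gaussian white noise sequence model, then for every $0<\beta_1\le\beta_2$ and every $L$ with $0<L\le L_0-1$ there exist constants $M,B>0$ such that, for all $\beta\in[\beta_1,\beta_2]$ and all $n\ge2$, $$\sup_{\theta_0\in\mathcal H(\beta,L)}E^n_{\theta_0}\big[P^\pi\big(\theta:\ell_\infty(\theta,\theta_0)\ge M(n/\log n)^{-\beta/(2\beta+1)}\mid Y^n\big)\big]\le n^{-B}.$$
   Context: Index set: $\Lambda=\{(j,k): j\in\mathbb N=\{0,1,2,\dots\},\ k\in I_j\}$, where the $I_j$ are finite sets with $|I_j|$ of order $2^j$ (i.e. $c_12^j\le|I_j|\le c_22^j$ for fixed constants $0<c_1\le c_2$); $\Lambda$ indexes a compactly supported orthonormal wavelet basis of $L^2([0,1])$. The parameter space is $\ell^2(\Lambda)$. Gaussian white noise sequence model: under $P^n_{\theta}$, $\theta=(\theta_{j,k})\in\ell^2(\Lambda)$, one observes $Y^n=(Y_{j,k})_{(j,k)\in\Lambda}$ with $Y_{j,k}=\theta_{j,k}+n^{-1/2}\epsilon_{j,k}$, the $\epsilon_{j,k}$ being i.i.d. $\mathcal N(0,1)$. $E^n_\theta$ is the corresponding expectation and $P^\pi(\cdot\mid Y^n)$ the posterior distribution. Loss: $\ell_\infty(\theta,\theta')=\sum_{j\in\mathbb N}2^{j/2}\max_{k\in I_j}|\theta_{j,k}-\theta'_{j,k}|$.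 Hölder balls: $\mathcal H(\beta,L)=\{\theta:\ |\theta_{j,k}|\le L2^{-j(\beta+1/2)}\ \text{for all }(j,k)\in\Lambda\}$, $\beta,L>0$. Spike and slab prior: let $g$ be a bounded probability density on $\mathbb R$ with $\inf_{x\in[-L_0,L_0]}g(x)>0$. Set $J_n=\lfloor\log n/\log 2\rfloor$. Under $\pi$ (which depends on $n$) the $\theta_{j,k}$ are independent; for $j\le J_n$, $k\in I_j$, $\theta_{j,k}$ has law $\pi_j(dx)=(1-w_{j,n})\delta_0(dx)+w_{j,n}g(x)\,dx$, and for $j>J_n$, $\theta_{j,k}=0$. It is assumed that there are constants $K>0$, $\tau>1/2$ with $n^{-K}\le w_{j,n}\le 2^{-j(1+\tau)}$ for all $j\le J_n$. *)

theory Defs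
  imports "HOL-Probability.Probability"
begin

definition wavelet_index :: "(nat \<Rightarrow> 'k set) \<Rightarrow> (nat \<times> 'k) set" where
  "wavelet_index I = (SIGMA j:UNIV. I j)"

text \<open>A family indexed by \<open>\<Lambda>\<close> is a function that is \<open>undefined\<close> outside \<open>\<Lambda>\<close>, as in
  \<^const>\<open>PiM\<close>, so that equality of families is equality of functions.\<close>

definition ell2 :: "'i set \<Rightarrow> ('i \<Rightarrow> real) set" where
  "ell2 \<Lambda> = {\<theta> \<in> extensional \<Lambda>. (\<lambda>i. (\<theta> i)\<^sup>2) summable_on \<Lambda>}"

definition holder_ball :: "(nat \<Rightarrow> 'k set) \<Rightarrow> real \<Rightarrow> real \<Rightarrow> (nat \<times> 'k \<Rightarrow> real) set" where
  "holder_ball I \<beta> L =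
     {\<theta> \<in> ell2 (wavelet_index I). \<forall>j. \<forall>k\<in>I j. \<bar>\<theta> (j, k)\<bar> \<le> L * 2 powr (- (real j * (\<beta> + 1/2)))}"

text \<open>The loss may be infinite on \<open>\<ell>\<^sup>2(\<Lambda>)\<close>, hence its values in \<^typ>\<open>ennreal\<close>.
  The maximum is meaningful for finite nonempty \<open>I j\<close>.\<close>

definition loss_inf ::
  "(nat \<Rightarrow> 'k set) \<Rightarrow> (nat \<times> 'k \<Rightarrow> real) \<Rightarrow> (nat \<times> 'k \<Rightarrow> real) \<Rightarrow> ennreal" where
  "loss_inf I \<theta> \<theta>' =
     (\<Sum>j. ennreal (2 powr (real j / 2) * (MAX k\<in>I j. \<bar>\<theta> (j, k) - \<theta>' (j, k)\<bar>)))"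

definition observation_space :: "'i set \<Rightarrow> ('i \<Rightarrow> real) measure" where
  "observation_space \<Lambda> = PiM \<Lambda> (\<lambda>_. borel)"

definition gaussian_noise :: "'i set \<Rightarrow> ('i \<Rightarrow> real) measure" where
  "gaussian_noise \<Lambda> = PiM \<Lambda> (\<lambda>_. density lborel (\<lambda>x. ennreal (std_normal_density x)))"

text \<open>The law \<open>P\<^sup>n\<^sub>\<theta>\<close> of the observation.\<close>

definition white_noise_model :: "'i set \<Rightarrow> nat \<Rightarrow> ('i \<Rightarrow> real) \<Rightarrow> ('i \<Rightarrow> real) measure" where
  "white_noise_model \<Lambda> n \<theta> =
     distr (gaussian_noise \<Lambda>) (observation_space \<Lambda>)
       (\<lambda>\<epsilon>. \<lambda>i\<in>\<Lambda>. \<theta> i + real n powr (- 1/2) * \<epsilon> i)"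

text \<open>The law \<open>(1 - w) \<delta>\<^sub>0 + w g(x) dx\<close>. For \<open>w\<close> in the unit interval the set function is a
  measure, see the lemma below; otherwise \<^const>\<open>measure_of\<close> may yield a junk value.\<close>

definition spike_slab_law :: "(real \<Rightarrow> real) \<Rightarrow> real \<Rightarrow> real measure" where
  "spike_slab_law g w = measure_of UNIV (sets borel)
     (\<lambda>A. ennreal (1 - w) * emeasure (return borel 0) A
        + ennreal w * emeasure (density lborel (\<lambda>x. ennreal (g x))) A)"

lemma sets_spike_slab_law [simp, measurable_cong]: "sets (spike_slab_law g w) = sets borel"
  unfolding spike_slab_law_def
  by (metis sets.sigma_sets_eq sets_measure_of sets.space_closed space_borel)

lemma space_spike_slab_law [simp]: "space (spike_slab_law g w) = UNIV"
  using sets_eq_imp_space_eq[OF sets_spike_slab_law] by simp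

lemma emeasure_spike_slab_law:
  assumes "A \<in> sets borel"
  shows "emeasure (spike_slab_law g w) A =
    ennreal (1 - w) * emeasure (return borel 0) A
    + ennreal w * emeasure (density lborel (\<lambda>x. ennreal (g x))) A"
proof (rule emeasure_measure_of[OF spike_slab_law_def])
  show "countably_additive (sets (spike_slab_law g w))
    (\<lambda>A. ennreal (1 - w) * emeasure (return borel 0) A
        + ennreal w * emeasure (density lborel (\<lambda>x. ennreal (g x))) A)"
  proof (rule countably_additiveI)
    fix F :: "nat \<Rightarrow> real set"
    assume F: "range F \<subseteq> sets (spike_slab_law g w)" "disjoint_family F"
    have 1: "emeasure (return borel 0) (\<Union>i. F i) = (\<Sum>i. emeasure (return borel 0) (F i))"
      using F by (intro suminf_emeasure[symmetric]) auto
    have 2: "emeasure (density lborel (\<lambda>x. ennreal (g x))) (\<Union>i. F i)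
      = (\<Sum>i. emeasure (density lborel (\<lambda>x. ennreal (g x))) (F i))"
      using F by (intro suminf_emeasure[symmetric]) auto
    show "(\<Sum>i. ennreal (1 - w) * emeasure (return borel 0) (F i)
        + ennreal w * emeasure (density lborel (\<lambda>x. ennreal (g x))) (F i)) =
      ennreal (1 - w) * emeasure (return borel 0) (\<Union>i. F i)
        + ennreal w * emeasure (density lborel (\<lambda>x. ennreal (g x))) (\<Union>i. F i)"
      unfolding 1 2 by (simp add: suminf_add[symmetric])
  qed
qed (use assms in \<open>auto simp: positive_def\<close>)

definition cutoff_level :: "nat \<Rightarrow> nat" where
  "cutoff_level n = nat \<lfloor>ln (real n) / ln 2\<rfloor>"

text \<open>The weights \<open>w j n\<close> are indexed by level \<open>j\<close> and sample size \<open>n\<close>. The product law charges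
  only finitely supported families, so restricting it to \<open>\<ell>\<^sup>2(\<Lambda>)\<close> loses no mass.\<close>

definition spike_slab_prior ::
  "(nat \<Rightarrow> 'k set) \<Rightarrow> (real \<Rightarrow> real) \<Rightarrow> (nat \<Rightarrow> nat \<Rightarrow> real) \<Rightarrow> nat \<Rightarrow> (nat \<times> 'k \<Rightarrow> real) measure" where
  "spike_slab_prior I g w n = restrict_space
     (PiM (wavelet_index I)
        (\<lambda>(j, k). if j \<le> cutoff_level n then spike_slab_law g (w j n) else return borel 0))
     (ell2 (wavelet_index I))"

text \<open>\<open>Q\<close> is a version of the posterior for the prior \<open>\<pi>\<close> and the model \<open>P\<close> with sample
  space \<open>N\<close>: a regular conditional distribution of the parameter given the observation, where the
  parameter has law \<open>\<pi>\<close> and the observation has law \<open>P \<theta>\<close> given the parameter \<open>\<theta>\<close>; its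
  marginal law is \<open>\<pi> \<bind> P\<close>.\<close>

definition is_posterior ::
  "'a measure \<Rightarrow> 'b measure \<Rightarrow> ('a \<Rightarrow> 'b measure) \<Rightarrow> ('b \<Rightarrow> 'a measure) \<Rightarrow> bool" where
  "is_posterior \<pi> N P Q \<longleftrightarrow>
     Q \<in> N \<rightarrow>\<^sub>M prob_algebra \<pi> \<and>
     (\<forall>A\<in>sets \<pi>. \<forall>B\<in>sets N.
        (\<integral>\<^sup>+\<theta>\<in>A. emeasure (P \<theta>) B \<partial>\<pi>) = (\<integral>\<^sup>+y\<in>B. emeasure (Q y) A \<partial>(\<pi> \<bind> P)))"

end

theory Submission
  imports Defs
begin

text \<open>Write \<open>\<sigma> = n\<^bsup>-1/2\<^esup>\<close>. Under the prior and the model the pairs \<open>(\<theta>\<^sub>i, Y\<^sub>i)\<close> are independent, so the posterior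
  law of \<open>\<theta>\<^sub>i\<close> depends on \<open>Y\<^sub>i\<close> only and is given by Bayes' formula on the real line. This identifies any
  version of the posterior only up to null sets of the marginal law of \<open>Y\<close>, whereas the theorem
  integrates against \<open>P\<^sub>\<theta>\<close> for every \<open>\<theta>\<close> in a Hoelder ball, which the prior need not charge. The gap
  is closed by the fact that all laws \<open>P\<^sub>\<theta>\<close> with \<open>\<theta>\<close> in \<open>\<ell>\<^sup>2\<close> have the same null sets
  (\<open>white_noise_null_set_shift\<close>): a null set of the marginal law is null for \<open>P\<^sub>\<theta>\<close> for prior-almost
  every \<open>\<theta>\<close>, hence for every \<open>\<theta>\<close> in \<open>\<ell>\<^sup>2\<close>. The outcome is \<open>is_posterior_coordinate\<close>, and a union bound
  over the levels up to the cutoff reduces everything to integrals over the real line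
  (\<open>posterior_union_bound\<close>).

  Let \<open>X = (n / log n)\<^bsup>1/(2\<beta>+1)\<^esup>\<close>, so that the rate is \<open>X\<^bsup>-\<beta>\<^esup>\<close> and \<open>\<sigma> \<surd>(log n) = X\<^bsup>-(\<beta>+1/2)\<^esup>\<close>. Fix large
  constants \<open>A\<close> and \<open>D\<close>, and call a level \<open>j\<close> low if \<open>2\<^sup>j \<le> D\<^sup>2 X\<close>, high otherwise.

  On a low level the posterior puts expected mass \<open>O(n\<^bsup>K+1/2-A\<^esup>)\<close> on distances from the true coefficient larger than
  \<open>8 \<surd>A \<sigma> \<surd>(log n)\<close>, because the slab charges a \<open>\<sigma>\<close>-neighbourhood of the truth with mass at least of
  order \<open>n\<^bsup>-K-1/2\<^esup>\<close> (\<open>posterior_far_from_truth\<close>). On a high level up to the cutoff the true coefficient is at most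
  \<open>(L / D) \<sigma> \<surd>(log n)\<close>, a small multiple of the noise level, and the weight \<open>w\<close> together with the
  Bayes factor of the slab, which is of order \<open>\<sigma>\<close> up to a small power of \<open>n\<close>, makes the expected
  posterior probability of a nonzero coefficient small (\<open>posterior_slab_small_signal\<close>); these
  probabilities are summable over the high levels since \<open>2\<^sup>j w\<close> decays geometrically
  (\<open>level_sum_bounds\<close>).

  Off these events the loss is at most a sum of \<open>2\<^bsup>j/2\<^esup> \<sigma> \<surd>(log n)\<close> over the low levels, dominated by
  the last of them, and a sum of \<open>L 2\<^bsup>-j\<beta>\<^esup>\<close> over the other levels, dominated by the first of
  them; both are of order \<open>X\<^bsup>-\<beta>\<^esup>\<close> (\<open>loss_inf_le\<close>).

  Since \<open>n \<ge> 2\<close>, a constant factor is absorbed either by a larger exponent \<open>A\<close> or by a larger \<open>D\<close>, so the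
  bound holds for all \<open>n\<close> and not only for large ones.\<close>

section \<open>Coordinates of product measures\<close>

lemma emeasure_PiM_coordinates:
  assumes "\<And>i. i \<in> \<Lambda> \<Longrightarrow> prob_space (M i)" "finite J" "J \<subseteq> \<Lambda>" "\<And>i. i \<in> J \<Longrightarrow> A i \<in> sets (M i)"
  shows "emeasure (PiM \<Lambda> M) {x \<in> space (PiM \<Lambda> M). \<forall>i\<in>J. x i \<in> A i} = (\<Prod>i\<in>J. emeasure (M i) (A i))"
proof -
  have "{x \<in> space (PiM \<Lambda> M). \<forall>i\<in>J. x i \<in> A i} = prod_emb \<Lambda> M J (Pi\<^sub>E J A)"
    using assms(3) by (auto simp: prod_emb_def space_PiM PiE_iff extensional_def)
  then show ?thesis
    using emeasure_PiM_emb[of \<Lambda> M J A] assms by simp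
qed

lemma measure_eqI_coordinates:
  assumes sets: "sets P = sets (PiM \<Lambda> M)" "sets P' = sets (PiM \<Lambda> M)" and fin: "finite_measure P"
    and eq: "\<And>J A. finite J \<Longrightarrow> J \<subseteq> \<Lambda> \<Longrightarrow> (\<And>i. i \<in> J \<Longrightarrow> A i \<in> sets (M i)) \<Longrightarrow>
      emeasure P {x \<in> space (PiM \<Lambda> M). \<forall>i\<in>J. x i \<in> A i} =
      emeasure P' {x \<in> space (PiM \<Lambda> M). \<forall>i\<in>J. x i \<in> A i}"
  shows "P = P'"
proof (rule measure_eqI_PiM_infinite[OF sets _ fin])
  fix A J assume J: "finite J" "J \<subseteq> \<Lambda>" "\<And>i. i \<in> J \<Longrightarrow> A i \<in> sets (M i)"
  have "{x \<in> space (PiM \<Lambda> M). \<forall>i\<in>J. x i \<in> A i} = prod_emb \<Lambda> M J (Pi\<^sub>E J A)"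
    using J(2) by (auto simp: prod_emb_def space_PiM PiE_iff extensional_def)
  then show "emeasure P (prod_emb \<Lambda> M J (Pi\<^sub>E J A)) = emeasure P' (prod_emb \<Lambda> M J (Pi\<^sub>E J A))"
    using eq[OF J] by simp
qed

lemma PiM_eqI_coordinates:
  assumes M: "\<And>i. i \<in> \<Lambda> \<Longrightarrow> prob_space (M i)"
    and sets: "sets P = sets (PiM \<Lambda> M)"
    and eq: "\<And>J A. finite J \<Longrightarrow> J \<subseteq> \<Lambda> \<Longrightarrow> (\<And>i. i \<in> J \<Longrightarrow> A i \<in> sets (M i)) \<Longrightarrow>
      emeasure P {x \<in> space (PiM \<Lambda> M). \<forall>i\<in>J. x i \<in> A i} = (\<Prod>i\<in>J. emeasure (M i) (A i))"
  shows "P = PiM \<Lambda> M"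
proof (rule measure_eqI_coordinates[OF refl sets, symmetric])
  interpret prob_space "PiM \<Lambda> M" by (rule prob_space_PiM) (rule M)
  show "finite_measure (PiM \<Lambda> M)" by unfold_locales
qed (simp add: eq emeasure_PiM_coordinates M)

text \<open>The index set may be infinite: the integrand depends on the coordinates in \<open>F\<close> only, and the
  projection of the product measure to \<open>F\<close> is the finite product.\<close>

lemma nn_integral_PiM_prod:
  assumes M: "\<And>i. i \<in> \<Lambda> \<Longrightarrow> prob_space (M i)" and F: "finite F" "F \<subseteq> \<Lambda>"
    and f: "\<And>i. i \<in> F \<Longrightarrow> f i \<in> borel_measurable (M i)"
  shows "(\<integral>\<^sup>+x. (\<Prod>i\<in>F. f i (x i)) \<partial>PiM \<Lambda> M) = (\<Prod>i\<in>F. \<integral>\<^sup>+x. f i x \<partial>M i)"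
proof -
  \<comment> \<open>The locale of infinite products asks for a probability measure at every index.\<close>
  define M' where "M' = (\<lambda>i. if i \<in> \<Lambda> then M i else return (count_space UNIV) undefined)"
  interpret M': prob_space "M' i" for i
    using M by (auto simp: M'_def intro!: prob_space_return)
  interpret product_prob_space M' \<Lambda> by unfold_locales
  interpret PF: product_prob_space M' F by unfold_locales
  have *: "(\<lambda>x. \<Prod>i\<in>F. f i (x i)) \<in> borel_measurable (PiM F M')"
    using F f by (intro borel_measurable_prod_ennreal measurable_compose[OF measurable_component_singleton]) (auto simp: M'_def)
  have "PiM \<Lambda> M = PiM \<Lambda> M'"
    by (intro PiM_cong) (auto simp: M'_def)
  then have "(\<integral>\<^sup>+x. (\<Prod>i\<in>F. f i (x i)) \<partial>PiM \<Lambda> M) = (\<integral>\<^sup>+x. (\<Prod>i\<in>F. f i (restrict x F i)) \<partial>PiM \<Lambda> M')"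
    by (auto intro!: nn_integral_cong prod.cong)
  also have "\<dots> = (\<integral>\<^sup>+x. (\<Prod>i\<in>F. f i (x i)) \<partial>distr (PiM \<Lambda> M') (PiM F M') (\<lambda>x. restrict x F))"
    using F * by (subst nn_integral_distr) (auto intro: measurable_restrict_subset)
  also have "\<dots> = (\<integral>\<^sup>+x. (\<Prod>i\<in>F. f i (x i)) \<partial>PiM F M')"
    using F by (simp add: distr_PiM_restrict_finite)
  also have "\<dots> = (\<Prod>i\<in>F. \<integral>\<^sup>+x. f i x \<partial>M' i)"
    using F f by (intro product_nn_integral_prod) (auto simp: M'_def)
  also have "\<dots> = (\<Prod>i\<in>F. \<integral>\<^sup>+x. f i x \<partial>M i)"
    using F by (intro prod.cong) (auto simp: M'_def)
  finally show ?thesis .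
qed

lemma nn_integral_PiM_coordinate:
  assumes "\<And>i. i \<in> \<Lambda> \<Longrightarrow> prob_space (M i)" "i \<in> \<Lambda>" "f \<in> borel_measurable (M i)"
  shows "(\<integral>\<^sup>+x. f (x i) \<partial>PiM \<Lambda> M) = (\<integral>\<^sup>+x. f x \<partial>M i)"
  using nn_integral_PiM_prod[of \<Lambda> M "{i}" "\<lambda>_. f"] assms by auto

section \<open>The white noise model as a product of normal laws\<close>

definition normal_law :: "real \<Rightarrow> real \<Rightarrow> real measure" where
  "normal_law t \<sigma> = density lborel (\<lambda>y. ennreal (normal_density t \<sigma> y))"

lemma sets_normal_law [simp, measurable_cong]: "sets (normal_law t \<sigma>) = sets borel"
  by (simp add: normal_law_def)

lemma space_normal_law [simp]: "space (normal_law t \<sigma>) = UNIV"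
  by (simp add: normal_law_def)

lemma prob_space_normal_law: "0 < \<sigma> \<Longrightarrow> prob_space (normal_law t \<sigma>)"
  unfolding normal_law_def by (rule prob_space_normal_density)

lemma nn_integral_normal_law:
  "f \<in> borel_measurable borel \<Longrightarrow>
    (\<integral>\<^sup>+y. f y \<partial>normal_law t \<sigma>) = (\<integral>\<^sup>+y. ennreal (normal_density t \<sigma> y) * f y \<partial>lborel)"
  unfolding normal_law_def by (subst nn_integral_density) auto

lemma nn_integral_normal_density:
  "0 < \<sigma> \<Longrightarrow> (\<integral>\<^sup>+y. ennreal (normal_density t \<sigma> y) \<partial>lborel) = 1"
  using prob_space.emeasure_space_1[OF prob_space_normal_law[of \<sigma> t]]
  by (simp add: normal_law_def emeasure_density)

lemma measurable_normal_density_pair [measurable]: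
  "(\<lambda>(t, y). normal_density t \<sigma> y) \<in> borel_measurable (borel \<Otimes>\<^sub>M borel)"
  unfolding normal_density_def by measurable

lemma borel_measurable_nn_integral_normal_law:
  assumes [measurable]: "f \<in> borel_measurable borel"
  shows "(\<lambda>t. \<integral>\<^sup>+y. f y \<partial>normal_law t \<sigma>) \<in> borel_measurable borel"
proof -
  have "(\<lambda>t. \<integral>\<^sup>+y. ennreal (normal_density t \<sigma> y) * f y \<partial>lborel) \<in> borel_measurable borel"
    by (intro sigma_finite_measure.borel_measurable_nn_integral sigma_finite_lborel) measurable
  then show ?thesis by (simp add: nn_integral_normal_law)
qed

lemma distr_affine_standard_normal:
  assumes "0 < \<sigma>"
  shows "distr (density lborel (\<lambda>x. ennreal (std_normal_density x))) borel (\<lambda>x. t + \<sigma> * x) = normal_law t \<sigma>"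
proof -
  let ?M = "density lborel (\<lambda>x. ennreal (std_normal_density x))"
  interpret prob_space ?M by (rule prob_space_normal_density) simp
  have "distributed ?M lborel (\<lambda>x. x) (\<lambda>x. ennreal (normal_density 0 1 x))"
    unfolding distributed_def by (auto simp: distr_id2)
  from normal_density_affine[OF this, of \<sigma> t] assms
  have "distributed ?M lborel (\<lambda>x. t + \<sigma> * x) (\<lambda>x. ennreal (normal_density t \<sigma> x))"
    by simp
  from distributed_distr_eq_density[OF this] show ?thesis
    by (simp add: normal_law_def cong: distr_cong)
qed

lemma white_noise_model_eq_PiM:
  assumes "1 \<le> n"
  shows "white_noise_model \<Lambda> n \<theta> = PiM \<Lambda> (\<lambda>i. normal_law (\<theta> i) (real n powr (- 1/2)))"
proof (rule PiM_eqI_coordinates)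
  define \<sigma> where "\<sigma> = real n powr (- 1/2)"
  have \<sigma>: "0 < \<sigma>" using assms by (simp add: \<sigma>_def)
  let ?std = "density lborel (\<lambda>x. ennreal (std_normal_density x))"
  let ?f = "\<lambda>\<epsilon>. \<lambda>i\<in>\<Lambda>. \<theta> i + \<sigma> * \<epsilon> i"
  have f: "?f \<in> PiM \<Lambda> (\<lambda>_. ?std) \<rightarrow>\<^sub>M PiM \<Lambda> (\<lambda>_. borel)"
    by (intro measurable_restrict) simp
  show "prob_space (normal_law (\<theta> i) (real n powr (- 1/2)))" for i
    using prob_space_normal_law[OF \<sigma>] unfolding \<sigma>_def .
  show "sets (white_noise_model \<Lambda> n \<theta>) = sets (PiM \<Lambda> (\<lambda>i. normal_law (\<theta> i) (real n powr (- 1/2))))"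
    unfolding white_noise_model_def observation_space_def
    by (simp cong: sets_PiM_cong)
  fix J A assume J: "finite J" "J \<subseteq> \<Lambda>" "\<And>i. i \<in> J \<Longrightarrow> A i \<in> sets (normal_law (\<theta> i) (real n powr (- 1/2)))"
  let ?S = "{x \<in> space (PiM \<Lambda> (\<lambda>i. normal_law (\<theta> i) (real n powr (- 1/2)))). \<forall>i\<in>J. x i \<in> A i}"
  have S: "?S \<in> sets (PiM \<Lambda> (\<lambda>_. borel))"
  proof -
    have "?S = {x \<in> space (PiM \<Lambda> (\<lambda>_. borel)). \<forall>i\<in>J. x i \<in> A i}"
      by (auto simp: space_PiM)
    also have "\<dots> \<in> sets (PiM \<Lambda> (\<lambda>_. borel))"
      using J by (intro sets.sets_Collect_finite_All) auto
    finally show ?thesis .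
  qed
  have "emeasure (white_noise_model \<Lambda> n \<theta>) ?S = emeasure (PiM \<Lambda> (\<lambda>_. ?std)) (?f -` ?S \<inter> space (PiM \<Lambda> (\<lambda>_. ?std)))"
    using f S unfolding white_noise_model_def observation_space_def gaussian_noise_def \<sigma>_def
    by (intro emeasure_distr) auto
  also have "?f -` ?S \<inter> space (PiM \<Lambda> (\<lambda>_. ?std)) =
      {x \<in> space (PiM \<Lambda> (\<lambda>_. ?std)). \<forall>i\<in>J. x i \<in> (\<lambda>x. \<theta> i + \<sigma> * x) -` A i}"
    using J(2) by (auto simp: space_PiM)
  also have "emeasure (PiM \<Lambda> (\<lambda>_. ?std)) \<dots> = (\<Prod>i\<in>J. emeasure ?std ((\<lambda>x. \<theta> i + \<sigma> * x) -` A i))"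
    using J by (intro emeasure_PiM_coordinates prob_space_normal_density)
      (auto intro!: measurable_sets_borel[of _ borel])
  also have "\<dots> = (\<Prod>i\<in>J. emeasure (normal_law (\<theta> i) \<sigma>) (A i))"
    using J by (intro prod.cong refl, subst distr_affine_standard_normal[OF \<sigma>, symmetric], subst emeasure_distr) auto
  finally show "emeasure (white_noise_model \<Lambda> n \<theta>) ?S =
      (\<Prod>i\<in>J. emeasure (normal_law (\<theta> i) (real n powr (- 1/2))) (A i))"
    by (simp add: \<sigma>_def)
qed

lemma white_noise_model_measurable:
  "white_noise_model \<Lambda> n \<in> PiM \<Lambda> (\<lambda>_. borel) \<rightarrow>\<^sub>M subprob_algebra (observation_space \<Lambda>)"
proof -
  interpret G: prob_space "gaussian_noise \<Lambda>"
    unfolding gaussian_noise_def by (intro prob_space_PiM prob_space_normal_density) simp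
  have sets: "sets (gaussian_noise \<Lambda>) = sets (PiM \<Lambda> (\<lambda>_. borel))"
    unfolding gaussian_noise_def by (intro sets_PiM_cong) auto
  have "(\<lambda>\<theta>. distr (gaussian_noise \<Lambda>) (observation_space \<Lambda>) (\<lambda>\<epsilon>. \<lambda>i\<in>\<Lambda>. \<theta> i + real n powr (- 1/2) * \<epsilon> i))
      \<in> PiM \<Lambda> (\<lambda>_. borel) \<rightarrow>\<^sub>M subprob_algebra (observation_space \<Lambda>)"
  proof (rule measurable_distr2)
    show "(\<lambda>_. gaussian_noise \<Lambda>) \<in> PiM \<Lambda> (\<lambda>_. borel) \<rightarrow>\<^sub>M subprob_algebra (PiM \<Lambda> (\<lambda>_. borel))"
      using G.subprob_space_axioms sets by (intro measurable_const) (auto simp: space_subprob_algebra)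
    show "(\<lambda>(\<theta>, \<epsilon>). \<lambda>i\<in>\<Lambda>. \<theta> i + real n powr (- 1/2) * \<epsilon> i)
        \<in> PiM \<Lambda> (\<lambda>_. borel) \<Otimes>\<^sub>M PiM \<Lambda> (\<lambda>_. borel) \<rightarrow>\<^sub>M observation_space \<Lambda>"
      unfolding observation_space_def by measurable
  qed
  then show ?thesis unfolding white_noise_model_def .
qed

section \<open>Mutual absolute continuity of the laws of the observation\<close>

text \<open>The sets that can be approximated in this sense form a \<open>\<sigma>\<close>-algebra: a countable union is close to
  a finite one, whose members are approximated one by one. Two measures are treated at
  once because the approximating set must serve both.\<close>

lemma measure_approx_by_algebra:
  fixes M N :: "'a measure"
  assumes "finite_measure M" "finite_measure N"
    and alg: "algebra \<Omega> G" and M: "sets M = sigma_sets \<Omega> G" and N: "sets N = sets M"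
    and B: "B \<in> sets M" and e: "0 < e"
  shows "\<exists>A\<in>G. measure M (sym_diff B A) < e \<and> measure N (sym_diff B A) < e"
proof -
  interpret M: finite_measure M by fact
  interpret N: finite_measure N by fact
  interpret G: algebra \<Omega> G by fact
  have G_sets: "A \<in> sets M" if "A \<in> G" for A
    using that by (simp add: M sigma_sets.Basic)
  have \<Omega>: "space M = \<Omega>" "space N = \<Omega>"
    using sets_eq_imp_space_eq[OF N] sigma_sets_into_sp[OF G.space_closed] M G.top
    by (metis G_sets sets.sets_into_space sets.top subset_antisym)+
  have "B \<in> sigma_sets \<Omega> G" using B M by simp
  then show ?thesis using e
  proof (induction arbitrary: e)
    case (Basic a)
    then show ?case by (intro bexI[of _ a]) auto
  next
    case Empty
    then show ?case by (intro bexI[of _ "{}"]) auto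
  next
    case (Compl a)
    then obtain A where A: "A \<in> G" "measure M (sym_diff a A) < e" "measure N (sym_diff a A) < e" by blast
    have "a \<subseteq> \<Omega>" "A \<subseteq> \<Omega>"
      using Compl(1) A(1) sigma_sets_into_sp[OF G.space_closed] G.space_closed by auto
    then have "sym_diff (\<Omega> - a) (\<Omega> - A) = sym_diff a A" by auto
    then show ?case using A by (intro bexI[of _ "\<Omega> - A"]) auto
  next
    case (Union a)
    let ?U = "\<Union>i. a i" and ?V = "\<lambda>k. \<Union>i<k. a i"
    have a: "a i \<in> sets M" for i using Union(1) M by simp
    have *: "eventually (\<lambda>k. measure L (?U - ?V k) < e / 2) sequentially"
      if "finite_measure L" "sets L = sets M" for L
    proof -
      interpret L: finite_measure L by fact
      have "(\<lambda>k. measure L (?V k)) \<longlonglongrightarrow> measure L (\<Union>k. ?V k)"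
        using a that by (intro L.finite_Lim_measure_incseq) (auto simp: incseq_def intro: order.strict_trans2)
      moreover have "(\<Union>k. ?V k) = ?U" by auto
      ultimately have "(\<lambda>k. measure L (?V k)) \<longlonglongrightarrow> measure L ?U" by simp
      from tendsto_diff[OF tendsto_const[of "measure L ?U"] this] have "(\<lambda>k. measure L ?U - measure L (?V k)) \<longlonglongrightarrow> 0" by simp
      moreover have "measure L (?U - ?V k) = measure L ?U - measure L (?V k)" for k
        using a that by (intro L.finite_measure_Diff) auto
      ultimately have "(\<lambda>k. measure L (?U - ?V k)) \<longlonglongrightarrow> 0" by simp
      then show ?thesis using Union.prems by (intro order_tendstoD(2)) auto
    qed
    from eventually_conj[OF *[OF assms(1) refl] *[OF assms(2) N]]
    obtain k where k: "measure M (?U - ?V k) < e / 2" "measure N (?U - ?V k) < e / 2"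
      by (auto simp: eventually_sequentially)
    \<comment> \<open>A tolerance \<open>d\<close> for each of the \<open>k\<close> sets of the finite union that leaves \<open>e / 2\<close> to spare.\<close>
    define d where "d = e / (2 * (real k + 1))"
    have d: "0 < d" using Union.prems by (simp add: d_def)
    have kd: "real k * d < e / 2"
      using Union.prems by (simp add: d_def field_simps)
    have "\<exists>A\<in>G. measure M (sym_diff (a i) A) < d \<and> measure N (sym_diff (a i) A) < d" for i
      using Union.IH[OF d] .
    then obtain A where A: "\<And>i. A i \<in> G" "\<And>i. measure M (sym_diff (a i) (A i)) < d"
      "\<And>i. measure N (sym_diff (a i) (A i)) < d" by metis
    have A_sets: "A i \<in> sets M" for i using A G_sets by simp
    have AG: "(\<Union>i<k. A i) \<in> G" using A by auto
    have **: "measure L (sym_diff ?U (\<Union>i<k. A i)) < e"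
      if "finite_measure L" "sets L = sets M" "measure L (?U - ?V k) < e / 2"
        "\<And>i. measure L (sym_diff (a i) (A i)) < d" for L
    proof -
      interpret L: finite_measure L by fact
      have S: "sym_diff (a i) (A i) \<in> sets L" "?U - ?V k \<in> sets L" for i using a A_sets that by auto
      have "measure L (sym_diff ?U (\<Union>i<k. A i)) \<le> measure L ((?U - ?V k) \<union> (\<Union>i<k. sym_diff (a i) (A i)))"
        using S by (intro L.finite_measure_mono) auto
      also have "\<dots> \<le> measure L (?U - ?V k) + measure L (\<Union>i<k. sym_diff (a i) (A i))"
        using S by (intro measure_Un_le) auto
      also have "measure L (\<Union>i<k. sym_diff (a i) (A i)) \<le> (\<Sum>i<k. measure L (sym_diff (a i) (A i)))"
        using S by (intro L.finite_measure_subadditive_finite) auto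
      also have "\<dots> \<le> (\<Sum>i<k. d)"
        using that(4) by (intro sum_mono less_imp_le)
      also have "\<dots> = real k * d" by simp
      finally show ?thesis using that(3) kd by simp
    qed
    show ?case
      using AG **[OF assms(1) refl k(1) A(2)] **[OF assms(2) N k(2) A(3)] by blast
  qed
qed

text \<open>Domination in this quantitative form survives approximation, so it extends from the algebra to a
  \<open>Q\<close>-null set \<open>B\<close> up to errors that vanish as the approximation improves. It then says
  \<open>P B \<le> V / c\<close> for every \<open>c\<close>.\<close>

lemma null_set_transfer_from_algebra:
  assumes "finite_measure P" "finite_measure Q"
    and alg: "algebra \<Omega> G" and Q: "sets Q = sigma_sets \<Omega> G" and P: "sets P = sets Q"
    and bound: "\<And>A c. A \<in> G \<Longrightarrow> 0 < c \<Longrightarrow> measure P A \<le> V / c + c * measure Q A"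
    and B: "B \<in> sets Q" "measure Q B = 0"
  shows "measure P B = 0"
proof -
  interpret P: finite_measure P by fact
  interpret Q: finite_measure Q by fact
  interpret G: algebra \<Omega> G by fact
  have G_sets: "A \<in> sets Q" if "A \<in> G" for A
    using that by (simp add: Q sigma_sets.Basic)
  have 1: "measure P B \<le> (\<bar>V\<bar> + 2) / c" if c: "1 \<le> c" for c
  proof -
    \<comment> \<open>The error is amplified by \<open>c\<close>, so an approximation within \<open>1 / c\<^sup>2\<close> keeps it of order \<open>1 / c\<close>.\<close>
    obtain A where A: "A \<in> G" "measure Q (sym_diff B A) < 1 / c\<^sup>2" "measure P (sym_diff B A) < 1 / c\<^sup>2"
      using measure_approx_by_algebra[OF assms(2,1) alg Q P B(1), of "1 / c\<^sup>2"] c by auto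
    have As: "A \<in> sets Q" using A G_sets by simp
    have "measure P B \<le> measure P (A \<union> sym_diff B A)"
      using As B P by (intro P.finite_measure_mono) auto
    also have "\<dots> \<le> measure P A + measure P (sym_diff B A)"
      using As B P by (intro measure_Un_le) auto
    also have "measure P A \<le> V / c + c * measure Q A"
      using bound[OF A(1)] c by simp
    also have "measure Q A \<le> measure Q (B \<union> sym_diff B A)"
      using As B by (intro Q.finite_measure_mono) auto
    also have "\<dots> \<le> measure Q B + measure Q (sym_diff B A)"
      using As B by (intro measure_Un_le) auto
    also have "\<dots> \<le> 1 / c\<^sup>2" using A B by simp
    finally have "measure P B \<le> V / c + c * (1 / c\<^sup>2) + 1 / c\<^sup>2"
      using A(3) c by simp
    also have "c * (1 / c\<^sup>2) = 1 / c" using c by (simp add: power2_eq_square)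
    also have "V / c \<le> \<bar>V\<bar> / c" using c by (intro divide_right_mono) auto
    also have "1 / c\<^sup>2 \<le> 1 / c" using c by (simp add: power2_eq_square field_simps)
    finally show ?thesis by (simp add: add_divide_distrib)
  qed
  have "measure P B \<le> 0 + e" if e: "0 < e" for e
  proof -
    have "measure P B \<le> (\<bar>V\<bar> + 2) / ((\<bar>V\<bar> + 2) / e + 1)"
      using e by (intro 1) auto
    also have "\<dots> \<le> e" using e by (simp add: field_simps)
    finally show ?thesis by simp
  qed
  then have "measure P B \<le> 0" by (rule field_le_epsilon)
  then show ?thesis using measure_nonneg[of P B] by simp
qed

lemma normal_density_ratio:
  assumes "0 < \<sigma>"
  shows "normal_density a \<sigma> y / normal_density b \<sigma> y = exp (((y - b)\<^sup>2 - (y - a)\<^sup>2) / (2 * \<sigma>\<^sup>2))"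
proof -
  have "exp (((y - b)\<^sup>2 - (y - a)\<^sup>2) / (2 * \<sigma>\<^sup>2)) * exp (- (y - b)\<^sup>2 / (2 * \<sigma>\<^sup>2)) =
      exp (- (y - a)\<^sup>2 / (2 * \<sigma>\<^sup>2))"
    by (simp add: diff_divide_distrib flip: exp_add)
  then have "exp (((y - b)\<^sup>2 - (y - a)\<^sup>2) / (2 * \<sigma>\<^sup>2)) * normal_density b \<sigma> y = normal_density a \<sigma> y"
    by (simp add: normal_density_def)
  then show ?thesis
    using normal_density_pos[OF assms, of b y] by (simp add: divide_eq_eq)
qed

text \<open>Completing the square: the second moment of the likelihood ratio of two normal laws with the same
  variance is \<open>exp ((a - b)\<^sup>2 / \<sigma>\<^sup>2)\<close>.\<close>

lemma normal_density_ratio_squared: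
  assumes "0 < \<sigma>"
  shows "normal_density b \<sigma> y * (normal_density a \<sigma> y / normal_density b \<sigma> y)\<^sup>2 =
    exp ((a - b)\<^sup>2 / \<sigma>\<^sup>2) * normal_density (2 * a - b) \<sigma> y"
proof -
  have "- (y - b)\<^sup>2 / (2 * \<sigma>\<^sup>2) + 2 * (((y - b)\<^sup>2 - (y - a)\<^sup>2) / (2 * \<sigma>\<^sup>2)) =
      (a - b)\<^sup>2 / \<sigma>\<^sup>2 + - (y - (2 * a - b))\<^sup>2 / (2 * \<sigma>\<^sup>2)"
    using assms by (simp add: field_simps power2_eq_square)
  then have "exp (- (y - b)\<^sup>2 / (2 * \<sigma>\<^sup>2)) * (exp (((y - b)\<^sup>2 - (y - a)\<^sup>2) / (2 * \<sigma>\<^sup>2)))\<^sup>2 =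
      exp ((a - b)\<^sup>2 / \<sigma>\<^sup>2) * exp (- (y - (2 * a - b))\<^sup>2 / (2 * \<sigma>\<^sup>2))"
    by (simp flip: exp_add exp_double)
  then show ?thesis
    unfolding normal_density_ratio[OF assms] by (simp add: normal_density_def)
qed

text \<open>On a cylinder over \<open>F\<close> the shifted product law has the density \<open>\<rho>\<close>, a product of likelihood ratios,
  with second moment at most \<open>exp (C / \<sigma>\<^sup>2)\<close> however large \<open>F\<close> is. The bound is the integral
  of \<open>\<rho> \<le> \<rho>\<^sup>2 / c + c\<close> over the cylinder.\<close>

lemma PiM_normal_cylinder_bound:
  fixes a b :: "'i \<Rightarrow> real"
  assumes \<sigma>: "0 < \<sigma>" and F: "finite F" "F \<subseteq> \<Lambda>"
    and C: "(\<Sum>i\<in>F. (a i - b i)\<^sup>2) \<le> C"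
    and X: "X \<in> sets (PiM F (\<lambda>_. borel))" and c: "0 < c"
  shows "measure (PiM \<Lambda> (\<lambda>i. normal_law (a i) \<sigma>)) (prod_emb \<Lambda> (\<lambda>_. borel) F X) \<le>
    exp (C / \<sigma>\<^sup>2) / c + c * measure (PiM \<Lambda> (\<lambda>i. normal_law (b i) \<sigma>)) (prod_emb \<Lambda> (\<lambda>_. borel) F X)"
proof -
  define Na where "Na = (\<lambda>i. normal_law (a i) \<sigma>)"
  define Nb where "Nb = (\<lambda>i. normal_law (b i) \<sigma>)"
  \<comment> \<open>The law with shifted means on \<open>F\<close> only; it agrees with the fully shifted one on cylinders over \<open>F\<close>.\<close>
  define Nm where "Nm = (\<lambda>i. if i \<in> F then Na i else Nb i)"
  have [simp]: "sets (Na i) = sets borel" "sets (Nb i) = sets borel" "sets (Nm i) = sets borel"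
    "space (Na i) = UNIV" "space (Nb i) = UNIV" "space (Nm i) = UNIV" for i
    by (auto simp: Na_def Nb_def Nm_def)
  have meas [simp]: "f \<in> borel_measurable (Nb i) \<longleftrightarrow> f \<in> borel_measurable borel" for f :: "real \<Rightarrow> ennreal" and i
    using measurable_cong_sets[of "Nb i" borel "borel :: ennreal measure" borel] by simp
  interpret a: prob_space "Na i" for i unfolding Na_def by (rule prob_space_normal_law[OF \<sigma>])
  interpret b: prob_space "Nb i" for i unfolding Nb_def by (rule prob_space_normal_law[OF \<sigma>])
  interpret m: prob_space "Nm i" for i using a.prob_space_axioms[of i] b.prob_space_axioms[of i] by (cases "i \<in> F") (simp_all add: Nm_def)
  interpret A: product_prob_space Na \<Lambda> by unfold_locales
  interpret B: product_prob_space Nb \<Lambda> by unfold_locales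
  interpret M: product_prob_space Nm \<Lambda> by unfold_locales
  define r where "r = (\<lambda>i y. normal_density (a i) \<sigma> y / normal_density (b i) \<sigma> y)"
  have r_meas [measurable]: "r i \<in> borel_measurable borel" for i by (simp add: r_def)
  have r_nn: "0 \<le> r i y" for i y by (simp add: r_def)
  define \<rho> where "\<rho> = (\<lambda>y. \<Prod>i\<in>F. r i (y i))"
  have comp [measurable]: "i \<in> F \<Longrightarrow> (\<lambda>y. y i) \<in> PiM \<Lambda> Nb \<rightarrow>\<^sub>M borel" for i
    using F measurable_component_singleton[of i \<Lambda> Nb] by (auto cong: measurable_cong_sets)
  have \<rho>_meas [measurable]: "\<rho> \<in> borel_measurable (PiM \<Lambda> Nb)"
    unfolding \<rho>_def by measurable
  have \<rho>_nn: "0 \<le> \<rho> y" for y unfolding \<rho>_def by (intro prod_nonneg) (auto simp: r_nn)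
  have int_r: "(\<integral>\<^sup>+y. ennreal (r i y) * indicator S y \<partial>Nb i) = emeasure (Na i) S" if "S \<in> sets borel" for i S
  proof -
    have "(\<integral>\<^sup>+y. ennreal (r i y) * indicator S y \<partial>Nb i) =
        (\<integral>\<^sup>+y. ennreal (normal_density (b i) \<sigma> y) * (ennreal (r i y) * indicator S y) \<partial>lborel)"
      unfolding Nb_def using that by (intro nn_integral_normal_law) auto
    also have "\<dots> = (\<integral>\<^sup>+y. ennreal (normal_density (a i) \<sigma> y) * indicator S y \<partial>lborel)"
      using normal_density_pos[OF \<sigma>, of "b i"]
      by (intro nn_integral_cong) (auto simp: r_def mult.assoc[symmetric] ennreal_mult[symmetric] less_imp_neq[THEN not_sym])
    also have "\<dots> = emeasure (Na i) S"
      unfolding Na_def normal_law_def using that by (simp add: emeasure_density)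
    finally show ?thesis .
  qed
  have int_r2: "(\<integral>\<^sup>+y. ennreal ((r i y)\<^sup>2) \<partial>Nb i) = ennreal (exp ((a i - b i)\<^sup>2 / \<sigma>\<^sup>2))" for i
  proof -
    have "(\<integral>\<^sup>+y. ennreal ((r i y)\<^sup>2) \<partial>Nb i) =
        (\<integral>\<^sup>+y. ennreal (normal_density (b i) \<sigma> y) * ennreal ((r i y)\<^sup>2) \<partial>lborel)"
      unfolding Nb_def by (intro nn_integral_normal_law) auto
    also have "\<dots> = (\<integral>\<^sup>+y. ennreal (exp ((a i - b i)\<^sup>2 / \<sigma>\<^sup>2)) * ennreal (normal_density (2 * a i - b i) \<sigma> y) \<partial>lborel)"
      by (intro nn_integral_cong) (simp add: r_def normal_density_ratio_squared[OF \<sigma>] flip: ennreal_mult)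
    also have "\<dots> = ennreal (exp ((a i - b i)\<^sup>2 / \<sigma>\<^sup>2))"
      by (simp add: nn_integral_cmult nn_integral_normal_density[OF \<sigma>])
    finally show ?thesis .
  qed
  have dens: "density (PiM \<Lambda> Nb) (\<lambda>y. ennreal (\<rho> y)) = PiM \<Lambda> Nm"
  proof (rule PiM_eqI_coordinates)
    show "prob_space (Nm i)" for i by unfold_locales
    show "sets (density (PiM \<Lambda> Nb) (\<lambda>y. ennreal (\<rho> y))) = sets (PiM \<Lambda> Nm)"
      by (simp cong: sets_PiM_cong)
    fix J S assume J: "finite J" "J \<subseteq> \<Lambda>" "\<And>i. i \<in> J \<Longrightarrow> S i \<in> sets (Nm i)"
    let ?R = "{x \<in> space (PiM \<Lambda> Nm). \<forall>i\<in>J. x i \<in> S i}"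
    have sp: "space (PiM \<Lambda> Nm) = space (PiM \<Lambda> Nb)" by (simp add: space_PiM)
    have R: "?R \<in> sets (PiM \<Lambda> Nb)"
      unfolding sp using J by (intro sets.sets_Collect_finite_All) (auto intro!: sets_Collect_single')
    define f where "f = (\<lambda>i y. (if i \<in> F then ennreal (r i y) else 1) * (if i \<in> J then indicator (S i) y else 1 :: ennreal))"
    have "emeasure (density (PiM \<Lambda> Nb) (\<lambda>y. ennreal (\<rho> y))) ?R = (\<integral>\<^sup>+y. ennreal (\<rho> y) * indicator ?R y \<partial>PiM \<Lambda> Nb)"
      using R by (intro emeasure_density) auto
    also have "\<dots> = (\<integral>\<^sup>+y. (\<Prod>i\<in>F \<union> J. f i (y i)) \<partial>PiM \<Lambda> Nb)"
    proof (intro nn_integral_cong)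
      fix y assume y: "y \<in> space (PiM \<Lambda> Nb)"
      have "(\<Prod>i\<in>F \<union> J. if i \<in> F then ennreal (r i (y i)) else 1) = (\<Prod>i\<in>F. ennreal (r i (y i)))"
        using F J by (intro prod.mono_neutral_cong_right) auto
      also have "\<dots> = ennreal (\<rho> y)"
        unfolding \<rho>_def by (simp add: prod_ennreal r_nn)
      moreover have "(\<Prod>i\<in>F \<union> J. if i \<in> J then indicator (S i) (y i) else 1 :: ennreal) = (\<Prod>i\<in>J. indicator (S i) (y i))"
        using F J by (intro prod.mono_neutral_cong_right) auto
      moreover have "(\<Prod>i\<in>J. indicator (S i) (y i) :: ennreal) = indicator ?R y"
        using J(1) y sp by (auto simp: indicator_def prod_zero_iff)
      ultimately show "ennreal (\<rho> y) * indicator ?R y = (\<Prod>i\<in>F \<union> J. f i (y i))"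
        unfolding f_def by (simp add: prod.distrib)
    qed
    also have "\<dots> = (\<Prod>i\<in>F \<union> J. \<integral>\<^sup>+y. f i y \<partial>Nb i)"
    proof (intro nn_integral_PiM_prod)
      show "f i \<in> borel_measurable (Nb i)" if "i \<in> F \<union> J" for i
        using that J(3)[of i] by (cases "i \<in> J") (auto simp: f_def)
    qed (use F J in \<open>auto intro: b.prob_space_axioms\<close>)
    also have "\<dots> = (\<Prod>i\<in>F \<union> J. if i \<in> J then emeasure (Nm i) (S i) else 1)"
    proof (intro prod.cong refl)
      fix i assume "i \<in> F \<union> J"
      then show "(\<integral>\<^sup>+y. f i y \<partial>Nb i) = (if i \<in> J then emeasure (Nm i) (S i) else 1)"
        using J(3)[of i] int_r[of "S i" i] int_r[of UNIV i] a.emeasure_space_1[of i]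
        by (auto simp: f_def Nm_def)
    qed
    also have "\<dots> = (\<Prod>i\<in>J. emeasure (Nm i) (S i))"
      using F J by (intro prod.mono_neutral_cong_right) auto
    finally show "emeasure (density (PiM \<Lambda> Nb) (\<lambda>y. ennreal (\<rho> y))) ?R = (\<Prod>i\<in>J. emeasure (Nm i) (S i))" .
  qed
  have int_\<rho>2: "(\<integral>\<^sup>+y. ennreal ((\<rho> y)\<^sup>2) \<partial>PiM \<Lambda> Nb) \<le> ennreal (exp (C / \<sigma>\<^sup>2))"
  proof -
    have "(\<integral>\<^sup>+y. ennreal ((\<rho> y)\<^sup>2) \<partial>PiM \<Lambda> Nb) = (\<integral>\<^sup>+y. (\<Prod>i\<in>F. ennreal ((r i (y i))\<^sup>2)) \<partial>PiM \<Lambda> Nb)"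
      by (simp add: \<rho>_def prod_ennreal flip: prod_power_distrib)
    also have "\<dots> = (\<Prod>i\<in>F. \<integral>\<^sup>+y. ennreal ((r i y)\<^sup>2) \<partial>Nb i)"
      using F by (intro nn_integral_PiM_prod) (auto intro: b.prob_space_axioms)
    also have "\<dots> = ennreal (exp (\<Sum>i\<in>F. (a i - b i)\<^sup>2 / \<sigma>\<^sup>2))"
      using F by (simp add: int_r2 exp_sum prod_ennreal)
    also have "\<dots> \<le> ennreal (exp (C / \<sigma>\<^sup>2))"
      using C \<sigma> by (simp add: divide_right_mono flip: sum_divide_distrib)
    finally show ?thesis .
  qed
  let ?E = "prod_emb \<Lambda> (\<lambda>_. borel) F X"
  have emb: "prod_emb \<Lambda> Na F X = ?E" "prod_emb \<Lambda> Nm F X = ?E"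
    by (simp_all add: prod_emb_def)
  have X': "X \<in> sets (PiM F Na)" "X \<in> sets (PiM F Nm)" using X by (simp_all cong: sets_PiM_cong)
  have E: "?E \<in> sets (PiM \<Lambda> Nb)"
  proof -
    have "?E \<in> sets (PiM \<Lambda> (\<lambda>_. borel))" using F X by (intro measurable_prod_emb)
    then show ?thesis by (simp cong: sets_PiM_cong)
  qed
  have "emeasure (PiM \<Lambda> Na) ?E = emeasure (PiM F Na) X"
    using A.emeasure_PiM_emb'[OF F(2,1) X'(1)] by (simp add: emb)
  also have "PiM F Na = PiM F Nm" by (intro PiM_cong) (auto simp: Nm_def)
  also have "emeasure (PiM F Nm) X = emeasure (PiM \<Lambda> Nm) ?E"
    using M.emeasure_PiM_emb'[OF F(2,1) X'(2)] by (simp add: emb)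
  also have "\<dots> = (\<integral>\<^sup>+y. ennreal (\<rho> y) * indicator ?E y \<partial>PiM \<Lambda> Nb)"
    using E by (subst dens[symmetric], intro emeasure_density) auto
  also have "\<dots> \<le> (\<integral>\<^sup>+y. ennreal (1 / c) * ennreal ((\<rho> y)\<^sup>2) + ennreal c * indicator ?E y \<partial>PiM \<Lambda> Nb)"
  proof (intro nn_integral_mono)
    fix y
    have "\<rho> y \<le> 1 / c * (\<rho> y)\<^sup>2 + c"
    proof (cases "\<rho> y \<le> c")
      case True then show ?thesis using c by (simp add: add_increasing)
    next
      case False
      then have "\<rho> y * c \<le> \<rho> y * \<rho> y" using c by (intro mult_left_mono) auto
      then have "\<rho> y \<le> 1 / c * (\<rho> y)\<^sup>2" using c by (simp add: field_simps power2_eq_square)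
      then show ?thesis using c by simp
    qed
    then have "ennreal (\<rho> y) \<le> ennreal (1 / c) * ennreal ((\<rho> y)\<^sup>2) + ennreal c"
      using c by (simp flip: ennreal_mult ennreal_plus)
    then show "ennreal (\<rho> y) * indicator ?E y \<le> ennreal (1 / c) * ennreal ((\<rho> y)\<^sup>2) + ennreal c * indicator ?E y"
      by (auto simp: indicator_def)
  qed
  also have "\<dots> = ennreal (1 / c) * (\<integral>\<^sup>+y. ennreal ((\<rho> y)\<^sup>2) \<partial>PiM \<Lambda> Nb) + ennreal c * emeasure (PiM \<Lambda> Nb) ?E"
    using E by (simp add: nn_integral_add nn_integral_cmult)
  also have "\<dots> \<le> ennreal (1 / c) * ennreal (exp (C / \<sigma>\<^sup>2)) + ennreal c * emeasure (PiM \<Lambda> Nb) ?E"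
    by (intro add_mono mult_left_mono int_\<rho>2) auto
  also have "\<dots> = ennreal (exp (C / \<sigma>\<^sup>2) / c + c * measure (PiM \<Lambda> Nb) ?E)"
    using c by (simp add: B.P.emeasure_eq_measure ennreal_plus flip: ennreal_mult)
  finally have "measure (PiM \<Lambda> Na) ?E \<le> exp (C / \<sigma>\<^sup>2) / c + c * measure (PiM \<Lambda> Nb) ?E"
    using c unfolding A.P.emeasure_eq_measure by (subst (asm) ennreal_le_iff) simp_all
  then show ?thesis by (simp add: Na_def Nb_def)
qed

text \<open>One half of Kakutani's dichotomy for Gaussian product measures: a square summable shift of the means
  preserves null sets. The bound on cylinders is uniform in the number of coordinates, so it passes to
  all measurable sets.\<close>

lemma PiM_normal_null_set_shift:
  fixes a b :: "'i \<Rightarrow> real"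
  assumes \<sigma>: "0 < \<sigma>" and C: "\<And>F. finite F \<Longrightarrow> F \<subseteq> \<Lambda> \<Longrightarrow> (\<Sum>i\<in>F. (a i - b i)\<^sup>2) \<le> C"
    and Z: "Z \<in> sets (PiM \<Lambda> (\<lambda>_. borel))" "emeasure (PiM \<Lambda> (\<lambda>i. normal_law (b i) \<sigma>)) Z = 0"
  shows "emeasure (PiM \<Lambda> (\<lambda>i. normal_law (a i) \<sigma>)) Z = 0"
proof -
  let ?A = "PiM \<Lambda> (\<lambda>i. normal_law (a i) \<sigma>)" and ?B = "PiM \<Lambda> (\<lambda>i. normal_law (b i) \<sigma>)"
  interpret a: prob_space "normal_law (a i) \<sigma>" for i by (rule prob_space_normal_law[OF \<sigma>])
  interpret b: prob_space "normal_law (b i) \<sigma>" for i by (rule prob_space_normal_law[OF \<sigma>])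
  interpret A: product_prob_space "\<lambda>i. normal_law (a i) \<sigma>" \<Lambda> by unfold_locales
  interpret B: product_prob_space "\<lambda>i. normal_law (b i) \<sigma>" \<Lambda> by unfold_locales
  have sets: "sets ?A = sets ?B" "sets ?B = sets (PiM \<Lambda> (\<lambda>_. borel))"
    by (auto intro!: sets_PiM_cong)
  have "measure ?A Z = 0"
  proof (rule null_set_transfer_from_algebra)
    show "finite_measure ?A" "finite_measure ?B" by unfold_locales
    show "algebra (space ?B) B.generator" by (rule B.algebra_generator)
    show "sets ?B = sigma_sets (space ?B) B.generator" by (rule B.sets_PiM_generator)
    show "sets ?A = sets ?B" by (rule sets)
    show "Z \<in> sets ?B" using Z sets by simp
    show "measure ?B Z = 0" using Z by (simp add: measure_def)
    fix A and c :: real assume "A \<in> B.generator" and c: "0 < c"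
    then show "measure ?A A \<le> exp (C / \<sigma>\<^sup>2) / c + c * measure ?B A"
    proof (cases rule: B.generator.cases)
      case (1 F X)
      have "X \<in> sets (PiM F (\<lambda>_. borel))" using 1 by (simp cong: sets_PiM_cong)
      then show ?thesis
        using PiM_normal_cylinder_bound[OF \<sigma> 1(2,3) C[OF 1(2,3)] _ c, of X] 1
        by (simp add: prod_emb_def)
    qed
  qed
  then show ?thesis by (simp add: A.P.emeasure_eq_measure)
qed

lemma sum_square_le_infsum_ell2:
  assumes "\<theta> \<in> ell2 \<Lambda>" "finite F" "F \<subseteq> \<Lambda>"
  shows "(\<Sum>i\<in>F. (\<theta> i)\<^sup>2) \<le> (\<Sum>\<^sub>\<infinity>i\<in>\<Lambda>. (\<theta> i)\<^sup>2)"
  using assms by (intro finite_sum_le_infsum) (auto simp: ell2_def)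

lemma white_noise_null_set_shift:
  assumes n: "1 \<le> n" and \<theta>: "\<theta> \<in> ell2 \<Lambda>" "\<theta>' \<in> ell2 \<Lambda>"
    and AE: "AE y in white_noise_model \<Lambda> n \<theta>. P y"
  shows "AE y in white_noise_model \<Lambda> n \<theta>'. P y"
proof -
  define \<sigma> where "\<sigma> = real n powr (- 1/2)"
  have \<sigma>: "0 < \<sigma>" using n by (simp add: \<sigma>_def)
  let ?P = "\<lambda>\<theta>. PiM \<Lambda> (\<lambda>i. normal_law (\<theta> i) \<sigma>)"
  have eq: "white_noise_model \<Lambda> n \<theta> = ?P \<theta>" for \<theta>
    unfolding \<sigma>_def by (rule white_noise_model_eq_PiM[OF n])
  have sets: "sets (?P \<theta>) = sets (PiM \<Lambda> (\<lambda>_. borel))" for \<theta> :: "'a \<Rightarrow> real"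
    by (intro sets_PiM_cong) auto
  from AE obtain Z where Z: "{y \<in> space (?P \<theta>). \<not> P y} \<subseteq> Z" "Z \<in> sets (?P \<theta>)" "emeasure (?P \<theta>) Z = 0"
    unfolding eq by (auto elim!: AE_E)
  have "emeasure (?P \<theta>') Z = 0"
  proof (rule PiM_normal_null_set_shift[OF \<sigma>, where b=\<theta>])
    fix F assume F: "finite F" "F \<subseteq> \<Lambda>"
    have "(\<Sum>i\<in>F. (\<theta>' i - \<theta> i)\<^sup>2) \<le> (\<Sum>i\<in>F. 2 * (\<theta>' i)\<^sup>2 + 2 * (\<theta> i)\<^sup>2)"
    proof (intro sum_mono)
      fix i
      have "2 * (\<theta>' i)\<^sup>2 + 2 * (\<theta> i)\<^sup>2 - (\<theta>' i - \<theta> i)\<^sup>2 = (\<theta>' i + \<theta> i)\<^sup>2"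
        by (simp add: power2_eq_square algebra_simps)
      then show "(\<theta>' i - \<theta> i)\<^sup>2 \<le> 2 * (\<theta>' i)\<^sup>2 + 2 * (\<theta> i)\<^sup>2"
        by (metis diff_ge_0_iff_ge zero_le_power2)
    qed
    also have "\<dots> = 2 * (\<Sum>i\<in>F. (\<theta>' i)\<^sup>2) + 2 * (\<Sum>i\<in>F. (\<theta> i)\<^sup>2)"
      by (simp add: sum.distrib sum_distrib_left)
    also have "\<dots> \<le> 2 * (\<Sum>\<^sub>\<infinity>i\<in>\<Lambda>. (\<theta>' i)\<^sup>2) + 2 * (\<Sum>\<^sub>\<infinity>i\<in>\<Lambda>. (\<theta> i)\<^sup>2)"
      using sum_square_le_infsum_ell2[OF \<theta>(1) F] sum_square_le_infsum_ell2[OF \<theta>(2) F] by simp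
    finally show "(\<Sum>i\<in>F. (\<theta>' i - \<theta> i)\<^sup>2) \<le> 2 * (\<Sum>\<^sub>\<infinity>i\<in>\<Lambda>. (\<theta>' i)\<^sup>2) + 2 * (\<Sum>\<^sub>\<infinity>i\<in>\<Lambda>. (\<theta> i)\<^sup>2)" .
  qed (use Z sets[of \<theta>] in auto)
  moreover have "space (?P \<theta>) = space (?P \<theta>')" by (simp add: space_PiM)
  ultimately show ?thesis
    unfolding eq using Z sets[of \<theta>] sets[of \<theta>'] by (intro AE_I[where N=Z]) auto
qed

section \<open>The posterior law of a coordinate\<close>

text \<open>Countability of \<open>\<Lambda>\<close> enters through its finite subsets, over which boundedness of the partial sums of
  squares is a countable intersection.\<close>

lemma ell2_sets:
  fixes \<Lambda> :: "'i set"
  assumes "countable \<Lambda>"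
  shows "ell2 \<Lambda> \<in> sets (PiM \<Lambda> (\<lambda>_. borel))"
proof -
  let ?M = "PiM \<Lambda> (\<lambda>_. borel :: real measure)"
  define \<F> where "\<F> = {F. F \<subseteq> \<Lambda> \<and> finite F}"
  have "countable \<F>"
    using countable_Collect_finite_subset[OF assms] by (simp add: \<F>_def conj_commute)
  have "ell2 \<Lambda> = {\<theta> \<in> space ?M. \<exists>N::nat. \<forall>F\<in>\<F>. (\<Sum>i\<in>F. (\<theta> i)\<^sup>2) \<le> real N}"
  proof (intro set_eqI iffI)
    fix \<theta> assume \<theta>: "\<theta> \<in> ell2 \<Lambda>"
    obtain N :: nat where "(\<Sum>\<^sub>\<infinity>i\<in>\<Lambda>. (\<theta> i)\<^sup>2) \<le> real N" using real_arch_simple by blast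
    then have "\<forall>F\<in>\<F>. (\<Sum>i\<in>F. (\<theta> i)\<^sup>2) \<le> real N"
      using sum_square_le_infsum_ell2[OF \<theta>] by (fastforce simp: \<F>_def)
    then show "\<theta> \<in> {\<theta> \<in> space ?M. \<exists>N::nat. \<forall>F\<in>\<F>. (\<Sum>i\<in>F. (\<theta> i)\<^sup>2) \<le> real N}"
      using \<theta> by (auto simp: ell2_def space_PiM PiE_iff)
  next
    fix \<theta> assume "\<theta> \<in> {\<theta> \<in> space ?M. \<exists>N::nat. \<forall>F\<in>\<F>. (\<Sum>i\<in>F. (\<theta> i)\<^sup>2) \<le> real N}"
    then obtain N :: nat where N: "\<And>F. F \<in> \<F> \<Longrightarrow> (\<Sum>i\<in>F. (\<theta> i)\<^sup>2) \<le> real N" and ext: "\<theta> \<in> extensional \<Lambda>"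
      by (auto simp: space_PiM PiE_iff)
    have "(\<lambda>i. (\<theta> i)\<^sup>2) summable_on \<Lambda>"
      using N by (intro nonneg_bdd_above_summable_on bdd_aboveI[where M="real N"]) (auto simp: \<F>_def)
    then show "\<theta> \<in> ell2 \<Lambda>" using ext by (simp add: ell2_def)
  qed
  also have "\<dots> \<in> sets ?M"
  proof (rule sets.sets_Collect_countable_Ex, rule sets.sets_Collect_countable_All'[OF _ \<open>countable \<F>\<close>])
    fix N :: nat and F assume "F \<in> \<F>"
    then have [measurable]: "i \<in> F \<Longrightarrow> (\<lambda>\<theta>. \<theta> i) \<in> borel_measurable ?M" for i
      by (auto simp: \<F>_def)
    show "{\<theta> \<in> space ?M. (\<Sum>i\<in>F. (\<theta> i)\<^sup>2) \<le> real N} \<in> sets ?M" by measurable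
  qed
  finally show ?thesis .
qed

text \<open>This covers a prior whose coordinates vanish almost surely beyond a cutoff; for such a prior,
  restriction to \<^term>\<open>ell2 \<Lambda>\<close> loses no mass.\<close>

lemma AE_ell2_finite_support:
  fixes \<mu> :: "'i \<Rightarrow> real measure"
  assumes \<Lambda>: "countable \<Lambda>" and \<mu>: "\<And>i. i \<in> \<Lambda> \<Longrightarrow> prob_space (\<mu> i)" "\<And>i. i \<in> \<Lambda> \<Longrightarrow> sets (\<mu> i) = sets borel"
    and F: "finite F" "\<And>i. i \<in> \<Lambda> - F \<Longrightarrow> \<mu> i = return borel 0"
  shows "AE \<theta> in PiM \<Lambda> \<mu>. \<theta> \<in> ell2 \<Lambda>"
proof -
  define \<mu>' where "\<mu>' = (\<lambda>i. if i \<in> \<Lambda> then \<mu> i else return borel 0)"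
  have eq: "PiM \<Lambda> \<mu> = PiM \<Lambda> \<mu>'" by (intro PiM_cong) (auto simp: \<mu>'_def)
  interpret \<mu>': prob_space "\<mu>' i" for i
    using \<mu> by (auto simp: \<mu>'_def intro!: prob_space_return)
  interpret product_prob_space \<mu>' \<Lambda> by unfold_locales
  have "AE \<theta> in PiM \<Lambda> \<mu>'. \<theta> i = 0" if "i \<in> \<Lambda> - F" for i
  proof (rule AE_component)
    show "AE x in \<mu>' i. x = 0"
    proof -
      have "\<mu>' i = return borel 0" using F(2)[OF that] that by (simp add: \<mu>'_def)
      moreover have "AE x in return borel (0 :: real). x = 0" by (subst AE_return) auto
      ultimately show ?thesis by metis
    qed
  qed (use that in auto)
  then have "AE \<theta> in PiM \<Lambda> \<mu>'. \<forall>i\<in>\<Lambda> - F. \<theta> i = 0"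
    using \<Lambda> by (intro AE_ball_countable') auto
  then have "AE \<theta> in PiM \<Lambda> \<mu>'. \<theta> \<in> ell2 \<Lambda>"
  proof (rule AE_mp, intro AE_I2 impI)
    fix \<theta> assume \<theta>: "\<theta> \<in> space (PiM \<Lambda> \<mu>')" "\<forall>i\<in>\<Lambda> - F. \<theta> i = 0"
    have "(\<lambda>i. (\<theta> i)\<^sup>2) summable_on (\<Lambda> \<inter> F)" using F by (intro summable_on_finite) auto
    then have "(\<lambda>i. (\<theta> i)\<^sup>2) summable_on \<Lambda>"
      by (rule summable_on_cong_neutral[THEN iffD1, rotated -1]) (use \<theta> in auto)
    then show "\<theta> \<in> ell2 \<Lambda>" using \<theta> by (auto simp: ell2_def space_PiM PiE_iff)
  qed
  then show ?thesis unfolding eq .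
qed

text \<open>Bayes' formula for the posterior mass of \<open>S\<close> when the mean of a normal observation \<open>y\<close> has prior law
  \<open>\<mu>\<close>.\<close>

definition normal_posterior :: "real measure \<Rightarrow> real \<Rightarrow> real set \<Rightarrow> real \<Rightarrow> ennreal" where
  "normal_posterior \<mu> \<sigma> S y =
    (\<integral>\<^sup>+t. ennreal (normal_density t \<sigma> y) * indicator S t \<partial>\<mu>) / (\<integral>\<^sup>+t. ennreal (normal_density t \<sigma> y) \<partial>\<mu>)"

context
  fixes \<mu> :: "real measure" and \<sigma> :: real and S :: "real set"
  assumes \<mu>: "prob_space \<mu>" "sets \<mu> = sets borel" and \<sigma>: "0 < \<sigma>" and S [measurable]: "S \<in> sets borel"
begin

interpretation \<mu>: prob_space \<mu> by (rule \<mu>)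

lemma borel_measurable_normal_posterior: "normal_posterior \<mu> \<sigma> S \<in> borel_measurable borel"
proof -
  have [measurable_cong]: "sets \<mu> = sets borel" by (rule \<mu>)
  have "(\<lambda>y. \<integral>\<^sup>+t. ennreal (normal_density t \<sigma> y) * indicator S t \<partial>\<mu>) \<in> borel_measurable borel"
    "(\<lambda>y. \<integral>\<^sup>+t. ennreal (normal_density t \<sigma> y) \<partial>\<mu>) \<in> borel_measurable borel"
    by (intro \<mu>.borel_measurable_nn_integral; measurable)+
  then show ?thesis unfolding normal_posterior_def by measurable
qed

text \<open>Where the marginal density vanishes so does the numerator, and the quotient is \<open>0 / 0 = 0\<close>.\<close>

lemma normal_posterior_times_marginal:
  "normal_posterior \<mu> \<sigma> S y * (\<integral>\<^sup>+t. ennreal (normal_density t \<sigma> y) \<partial>\<mu>) =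
    (\<integral>\<^sup>+t. ennreal (normal_density t \<sigma> y) * indicator S t \<partial>\<mu>)" (is "_ * ?D = ?N")
proof -
  have "?D \<le> (\<integral>\<^sup>+t. ennreal (1 / sqrt (2 * pi * \<sigma>\<^sup>2)) \<partial>\<mu>)"
    by (intro nn_integral_mono ennreal_leI) (simp add: normal_density_def mult_left_le_one_le divide_right_mono)
  also have "\<dots> < top" by (simp add: \<mu>.emeasure_space_1)
  finally have fin: "?D \<noteq> top" by simp
  have "?N \<le> ?D" by (intro nn_integral_mono) (auto simp: indicator_def)
  then show ?thesis
    unfolding normal_posterior_def using fin
    by (cases "?D = 0") (auto simp: ennreal_divide_times less_top)
qed

text \<open>The defining equation of a posterior for a single coordinate. Exchanging the integrals turns the
  left side into the posterior mass times the marginal density, in which the denominator of Bayes'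
  formula cancels.\<close>

lemma normal_posterior_disintegration:
  assumes B [measurable]: "B \<in> sets borel"
  shows "(\<integral>\<^sup>+t. (\<integral>\<^sup>+y. normal_posterior \<mu> \<sigma> S y * indicator B y \<partial>normal_law t \<sigma>) \<partial>\<mu>) =
    (\<integral>\<^sup>+t. emeasure (normal_law t \<sigma>) B * indicator S t \<partial>\<mu>)"
proof -
  have [measurable_cong]: "sets \<mu> = sets borel" by (rule \<mu>)
  note [measurable] = borel_measurable_normal_posterior
  interpret pair_sigma_finite \<mu> lborel by unfold_locales
  have "(\<integral>\<^sup>+t. (\<integral>\<^sup>+y. normal_posterior \<mu> \<sigma> S y * indicator B y \<partial>normal_law t \<sigma>) \<partial>\<mu>) =
      (\<integral>\<^sup>+t. (\<integral>\<^sup>+y. ennreal (normal_density t \<sigma> y) * (normal_posterior \<mu> \<sigma> S y * indicator B y) \<partial>lborel) \<partial>\<mu>)"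
    by (simp add: nn_integral_normal_law)
  also have "\<dots> = (\<integral>\<^sup>+y. (\<integral>\<^sup>+t. ennreal (normal_density t \<sigma> y) * (normal_posterior \<mu> \<sigma> S y * indicator B y) \<partial>\<mu>) \<partial>lborel)"
    by (rule Fubini'[symmetric]) measurable
  also have "\<dots> = (\<integral>\<^sup>+y. (\<integral>\<^sup>+t. ennreal (normal_density t \<sigma> y) * indicator S t \<partial>\<mu>) * indicator B y \<partial>lborel)"
  proof (intro nn_integral_cong)
    fix y
    have "(\<integral>\<^sup>+t. ennreal (normal_density t \<sigma> y) * (normal_posterior \<mu> \<sigma> S y * indicator B y) \<partial>\<mu>) =
        (\<integral>\<^sup>+t. ennreal (normal_density t \<sigma> y) \<partial>\<mu>) * (normal_posterior \<mu> \<sigma> S y * indicator B y)"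
      by (rule nn_integral_multc) measurable
    then show "(\<integral>\<^sup>+t. ennreal (normal_density t \<sigma> y) * (normal_posterior \<mu> \<sigma> S y * indicator B y) \<partial>\<mu>) =
        (\<integral>\<^sup>+t. ennreal (normal_density t \<sigma> y) * indicator S t \<partial>\<mu>) * indicator B y"
      unfolding normal_posterior_times_marginal[symmetric] by (simp only: mult_ac)
  qed
  also have "\<dots> = (\<integral>\<^sup>+y. (\<integral>\<^sup>+t. ennreal (normal_density t \<sigma> y) * indicator B y * indicator S t \<partial>\<mu>) \<partial>lborel)"
    by (intro nn_integral_cong, subst nn_integral_multc[symmetric]) (auto intro!: nn_integral_cong simp: mult_ac)
  also have "\<dots> = (\<integral>\<^sup>+t. (\<integral>\<^sup>+y. ennreal (normal_density t \<sigma> y) * indicator B y * indicator S t \<partial>lborel) \<partial>\<mu>)"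
    by (rule Fubini') measurable
  also have "\<dots> = (\<integral>\<^sup>+t. emeasure (normal_law t \<sigma>) B * indicator S t \<partial>\<mu>)"
    by (simp add: nn_integral_multc normal_law_def emeasure_density)
  finally show ?thesis .
qed

end

lemma normal_posterior_le_1: "normal_posterior \<mu> \<sigma> S y \<le> 1"
proof -
  let ?N = "\<integral>\<^sup>+t. ennreal (normal_density t \<sigma> y) * indicator S t \<partial>\<mu>"
  let ?D = "\<integral>\<^sup>+t. ennreal (normal_density t \<sigma> y) \<partial>\<mu>"
  have "?N \<le> ?D" by (intro nn_integral_mono) (auto simp: indicator_def)
  then have "?N / ?D \<le> ?D / ?D" by (rule divide_right_mono_ennreal)
  also have "\<dots> \<le> 1" by (cases "?D = 0 \<or> ?D = top") (auto simp: less_top)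
  finally show ?thesis unfolding normal_posterior_def .
qed

lemma normal_posterior_return_0:
  "S \<in> sets borel \<Longrightarrow> 0 \<notin> S \<Longrightarrow> normal_posterior (return borel 0) \<sigma> S y = 0"
  unfolding normal_posterior_def by (subst nn_integral_return) auto

text \<open>Both sides of the defining equation of the posterior, with the event \<open>\<theta> i \<in> S\<close>, are finite measures in
  the observation event; on rectangles they factorise over the coordinates, and coordinate \<open>i\<close>
  contributes the disintegration on the real line. So the identity holds almost everywhere for the
  marginal law, hence almost everywhere for the law at some \<open>\<theta>\<close> in \<^term>\<open>ell2 \<Lambda>\<close>, and
  therefore at \<open>\<theta>\<^sub>0\<close>, which has the same null sets.\<close>

lemma is_posterior_coordinate:
  fixes \<mu> :: "'i \<Rightarrow> real measure"
  assumes \<Lambda>: "countable \<Lambda>" and n: "1 \<le> n"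
    and \<mu>: "\<And>i. i \<in> \<Lambda> \<Longrightarrow> prob_space (\<mu> i)" "\<And>i. i \<in> \<Lambda> \<Longrightarrow> sets (\<mu> i) = sets borel"
    and full: "AE \<theta> in PiM \<Lambda> \<mu>. \<theta> \<in> ell2 \<Lambda>"
    and Q: "is_posterior (restrict_space (PiM \<Lambda> \<mu>) (ell2 \<Lambda>)) (observation_space \<Lambda>) (white_noise_model \<Lambda> n) Q"
    and i: "i \<in> \<Lambda>" and S: "S \<in> sets borel" and \<theta>\<^sub>0: "\<theta>\<^sub>0 \<in> ell2 \<Lambda>"
  shows "AE y in white_noise_model \<Lambda> n \<theta>\<^sub>0. emeasure (Q y) {\<theta> \<in> ell2 \<Lambda>. \<theta> i \<in> S} =
    normal_posterior (\<mu> i) (real n powr (- 1/2)) S (y i)"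
proof -
  define \<sigma> where "\<sigma> = real n powr (- 1/2)"
  have \<sigma>: "0 < \<sigma>" using n by (simp add: \<sigma>_def)
  let ?O = "PiM \<Lambda> (\<lambda>_. borel :: real measure)"
  let ?P = "white_noise_model \<Lambda> n"
  define \<pi> where "\<pi> = restrict_space (PiM \<Lambda> \<mu>) (ell2 \<Lambda>)"
  define m where "m = \<pi> \<bind> ?P"
  define A where "A = {\<theta> \<in> ell2 \<Lambda>. \<theta> i \<in> S}"
  define R where "R = normal_posterior (\<mu> i) \<sigma> S"
  have O: "observation_space \<Lambda> = ?O" by (simp add: observation_space_def)
  have sets_PiM: "sets (PiM \<Lambda> \<mu>) = sets ?O" using \<mu>(2) by (intro sets_PiM_cong) auto
  have space_prior: "space (PiM \<Lambda> \<mu>) = space ?O" by (rule sets_eq_imp_space_eq[OF sets_PiM])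
  have ell2_meas: "ell2 \<Lambda> \<inter> space (PiM \<Lambda> \<mu>) \<in> sets (PiM \<Lambda> \<mu>)"
    using ell2_sets[OF \<Lambda>] sets_PiM by simp
  have space_\<pi>: "space \<pi> = ell2 \<Lambda>"
    unfolding \<pi>_def using sets.sets_into_space[OF ell2_sets[OF \<Lambda>]] by (auto simp: space_restrict_space space_prior)
  have P_eq: "?P \<theta> = PiM \<Lambda> (\<lambda>i. normal_law (\<theta> i) \<sigma>)" for \<theta>
    unfolding \<sigma>_def by (rule white_noise_model_eq_PiM[OF n])
  have prob_normal: "prob_space (normal_law t \<sigma>)" for t by (rule prob_space_normal_law[OF \<sigma>])
  have prob_P: "prob_space (?P \<theta>)" for \<theta>
    unfolding P_eq by (intro prob_space_PiM prob_normal)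
  have sets_P: "sets (?P \<theta>) = sets ?O" for \<theta>
    unfolding P_eq by (intro sets_PiM_cong) auto
  have P_meas: "?P \<in> \<pi> \<rightarrow>\<^sub>M subprob_algebra ?O"
    using white_noise_model_measurable[of \<Lambda> n] sets_PiM unfolding O \<pi>_def
    by (intro measurable_restrict_space1) (simp cong: measurable_cong_sets)
  interpret \<mu>P: prob_space "PiM \<Lambda> \<mu>" by (rule prob_space_PiM) (rule \<mu>)
  have int_\<pi>: "(\<integral>\<^sup>+\<theta>. f \<theta> \<partial>\<pi>) = (\<integral>\<^sup>+\<theta>. f \<theta> \<partial>PiM \<Lambda> \<mu>)" for f :: "('i \<Rightarrow> real) \<Rightarrow> ennreal"
    unfolding \<pi>_def using full
    by (subst nn_integral_restrict_space[OF ell2_meas], intro nn_integral_cong_AE) auto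
  have prob_\<pi>: "prob_space \<pi>"
    using int_\<pi>[of "\<lambda>_. 1"] \<mu>P.emeasure_space_1 by (intro prob_spaceI) simp
  interpret \<pi>: prob_space \<pi> by (rule prob_\<pi>)
  have space_\<pi>_ne: "space \<pi> \<noteq> {}" by (rule \<pi>.not_empty)
  have sets_m: "sets m = sets ?O"
    unfolding m_def using space_\<pi>_ne by (intro sets_bind) (auto simp: sets_P)
  have space_m: "space m = space ?O" by (rule sets_eq_imp_space_eq[OF sets_m])
  have int_m: "(\<integral>\<^sup>+y. f y \<partial>m) = (\<integral>\<^sup>+\<theta>. (\<integral>\<^sup>+y. f y \<partial>?P \<theta>) \<partial>PiM \<Lambda> \<mu>)"
    if "f \<in> borel_measurable ?O" for f :: "('i \<Rightarrow> real) \<Rightarrow> ennreal"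
    unfolding m_def using that P_meas by (subst nn_integral_bind) (auto simp: int_\<pi>)
  have A_sets: "A \<in> sets \<pi>"
  proof -
    have "A = {\<theta> \<in> space ?O. \<theta> i \<in> S} \<inter> ell2 \<Lambda>"
      using sets.sets_into_space[OF ell2_sets[OF \<Lambda>]] by (auto simp: A_def)
    moreover have "{\<theta> \<in> space ?O. \<theta> i \<in> S} \<in> sets ?O"
      using i S by (intro sets_Collect_single') auto
    ultimately show ?thesis unfolding \<pi>_def sets_restrict_space sets_PiM by (auto simp: Int_commute)
  qed
  have Q_meas: "Q \<in> ?O \<rightarrow>\<^sub>M subprob_algebra \<pi>"
    using Q unfolding is_posterior_def \<pi>_def O by (auto intro: measurable_prob_algebraD)
  have QA_meas: "(\<lambda>y. emeasure (Q y) A) \<in> borel_measurable ?O"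
    using measurable_compose[OF Q_meas measurable_emeasure_subprob_algebra[OF A_sets]] .
  have R_meas [measurable]: "R \<in> borel_measurable borel"
    unfolding R_def by (rule borel_measurable_normal_posterior[OF \<mu>(1)[OF i] \<mu>(2)[OF i] \<sigma> S])
  have Ri_meas: "(\<lambda>y. R (y i)) \<in> borel_measurable ?O" using i by measurable
  have Q_int: "(\<integral>\<^sup>+y. emeasure (Q y) A * indicator B y \<partial>m) =
      (\<integral>\<^sup>+\<theta>. emeasure (?P \<theta>) B * indicator A \<theta> \<partial>PiM \<Lambda> \<mu>)" if "B \<in> sets ?O" for B
    using Q A_sets that unfolding is_posterior_def \<pi>_def[symmetric] O m_def[symmetric] by (simp flip: int_\<pi>)
  have fin: "(\<integral>\<^sup>+y. emeasure (Q y) A \<partial>m) \<le> 1"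
  proof -
    have "(\<integral>\<^sup>+y. emeasure (Q y) A \<partial>m) = (\<integral>\<^sup>+y. emeasure (Q y) A * indicator (space ?O) y \<partial>m)"
      by (intro nn_integral_cong) (simp add: space_m)
    also have "\<dots> = (\<integral>\<^sup>+\<theta>. emeasure (?P \<theta>) (space ?O) * indicator A \<theta> \<partial>PiM \<Lambda> \<mu>)"
      by (rule Q_int) auto
    also have "\<dots> \<le> (\<integral>\<^sup>+\<theta>. 1 \<partial>PiM \<Lambda> \<mu>)"
      using prob_space.emeasure_le_1[OF prob_P]
      by (intro nn_integral_mono) (auto simp: indicator_def)
    finally show ?thesis by (simp add: \<mu>P.emeasure_space_1)
  qed
  have "density m (\<lambda>y. emeasure (Q y) A) = density m (\<lambda>y. R (y i))"
  proof (rule measure_eqI_coordinates)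
    show "sets (density m (\<lambda>y. emeasure (Q y) A)) = sets ?O" "sets (density m (\<lambda>y. R (y i))) = sets ?O"
      by (simp_all add: sets_m)
    show "finite_measure (density m (\<lambda>y. emeasure (Q y) A))"
    proof
      have "emeasure (density m (\<lambda>y. emeasure (Q y) A)) (space m) = (\<integral>\<^sup>+y. emeasure (Q y) A * indicator (space m) y \<partial>m)"
        using QA_meas sets_m by (intro emeasure_density) (auto cong: measurable_cong_sets)
      also have "\<dots> = (\<integral>\<^sup>+y. emeasure (Q y) A \<partial>m)" by (intro nn_integral_cong) auto
      finally show "emeasure (density m (\<lambda>y. emeasure (Q y) A)) (space (density m (\<lambda>y. emeasure (Q y) A))) \<noteq> \<infinity>"
        using fin by (auto simp: top_unique)
    qed
    fix J B assume J: "finite J" "J \<subseteq> \<Lambda>" and B: "\<And>i. i \<in> J \<Longrightarrow> B i \<in> sets (borel :: real measure)"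
    define B' where "B' = (\<lambda>l. if l \<in> J then B l else UNIV)"
    \<comment> \<open>The index \<open>i\<close> is added so that the posterior mass becomes one factor of the product.\<close>
    define F where "F = insert i J"
    have F: "finite F" "F \<subseteq> \<Lambda>" "i \<in> F" using J i by (auto simp: F_def)
    have B' [measurable]: "B' l \<in> sets borel" for l using B by (auto simp: B'_def)
    let ?E = "{y \<in> space ?O. \<forall>l\<in>J. y l \<in> B l}"
    have E: "?E \<in> sets ?O"
      using J B by (intro sets.sets_Collect_finite_All) (auto intro!: sets_Collect_single')
    \<comment> \<open>The factors at coordinate \<open>l\<close> of the two integrands: posterior mass times rectangle as a function of the observation, and probability of the rectangle times event as a function of the parameter.\<close>
    define u where "u = (\<lambda>l y. (if l = i then R y else 1) * indicator (B' l) y)"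
    define v where "v = (\<lambda>l t. emeasure (normal_law t \<sigma>) (B' l) * (if l = i then indicator S t else 1))"
    have u_meas: "u l \<in> borel_measurable borel" for l
      unfolding u_def by (cases "l = i") (simp_all del: mult_1_left, measurable)
    have e_meas: "(\<lambda>t. \<integral>\<^sup>+y. u l y \<partial>normal_law t \<sigma>) \<in> borel_measurable borel" for l
      by (rule borel_measurable_nn_integral_normal_law[OF u_meas])
    have v_meas: "v l \<in> borel_measurable borel" for l
    proof -
      have "(\<lambda>t. \<integral>\<^sup>+y. indicator (B' l) y \<partial>normal_law t \<sigma>) \<in> borel_measurable borel"
        by (rule borel_measurable_nn_integral_normal_law) measurable
      then have "(\<lambda>t. emeasure (normal_law t \<sigma>) (B' l)) \<in> borel_measurable borel" by simp
      then show ?thesis unfolding v_def using S by (cases "l = i") auto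
    qed
    have E_B': "y \<in> ?E \<longleftrightarrow> (\<forall>l\<in>F. y l \<in> B' l)" if "y \<in> space ?O" for y
      using that by (auto simp: F_def B'_def)
    have "emeasure (density m (\<lambda>y. R (y i))) ?E = (\<integral>\<^sup>+y. R (y i) * indicator ?E y \<partial>m)"
      using Ri_meas E sets_m by (intro emeasure_density) (auto cong: measurable_cong_sets)
    also have "\<dots> = (\<integral>\<^sup>+\<theta>. (\<integral>\<^sup>+y. R (y i) * indicator ?E y \<partial>?P \<theta>) \<partial>PiM \<Lambda> \<mu>)"
      using Ri_meas E by (intro int_m) auto
    also have "\<dots> = (\<integral>\<^sup>+\<theta>. (\<Prod>l\<in>F. \<integral>\<^sup>+y. u l y \<partial>normal_law (\<theta> l) \<sigma>) \<partial>PiM \<Lambda> \<mu>)"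
    proof (intro nn_integral_cong)
      fix \<theta>
      have "(\<integral>\<^sup>+y. R (y i) * indicator ?E y \<partial>?P \<theta>) = (\<integral>\<^sup>+y. (\<Prod>l\<in>F. u l (y l)) \<partial>?P \<theta>)"
      proof (intro nn_integral_cong)
        fix y assume "y \<in> space (?P \<theta>)"
        then have y: "y \<in> space ?O" using sets_eq_imp_space_eq[OF sets_P] by simp
        have "(\<Prod>l\<in>F. if l = i then R (y l) else 1) = R (y i)"
          using F by simp
        moreover have "(\<Prod>l\<in>F. indicator (B' l) (y l) :: ennreal) = indicator ?E y"
        proof (cases "y \<in> ?E")
          case True
          then have "\<forall>l\<in>F. y l \<in> B' l" using E_B'[OF y] by blast
          then have "(\<Prod>l\<in>F. indicator (B' l) (y l) :: ennreal) = 1" by (intro prod.neutral) auto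
          moreover have "indicator ?E y = (1 :: ennreal)" using True by (rule indicator_simps(1))
          ultimately show ?thesis by simp
        next
          case False
          then obtain l where "l \<in> F" "y l \<notin> B' l" using E_B'[OF y] by blast
          then have "(\<Prod>l\<in>F. indicator (B' l) (y l) :: ennreal) = 0"
            using F(1) by (intro prod_zero bexI[of _ l]) auto
          moreover have "indicator ?E y = (0 :: ennreal)" using False by (rule indicator_simps(2))
          ultimately show ?thesis by simp
        qed
        ultimately show "R (y i) * indicator ?E y = (\<Prod>l\<in>F. u l (y l))"
          unfolding u_def by (simp only: prod.distrib)
      qed
      also have "\<dots> = (\<Prod>l\<in>F. \<integral>\<^sup>+y. u l y \<partial>normal_law (\<theta> l) \<sigma>)"
        unfolding P_eq using F u_meas prob_normal by (intro nn_integral_PiM_prod) auto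
      finally show "(\<integral>\<^sup>+y. R (y i) * indicator ?E y \<partial>?P \<theta>) = (\<Prod>l\<in>F. \<integral>\<^sup>+y. u l y \<partial>normal_law (\<theta> l) \<sigma>)" .
    qed
    also have "\<dots> = (\<Prod>l\<in>F. \<integral>\<^sup>+t. (\<integral>\<^sup>+y. u l y \<partial>normal_law t \<sigma>) \<partial>\<mu> l)"
    proof (rule nn_integral_PiM_prod)
      show "(\<lambda>t. \<integral>\<^sup>+y. u l y \<partial>normal_law t \<sigma>) \<in> borel_measurable (\<mu> l)" if "l \<in> F" for l
        using e_meas[of l] \<mu>(2)[of l] that F by (simp add: subset_iff cong: measurable_cong_sets)
    qed (use F \<mu> in auto)
    also have "\<dots> = (\<Prod>l\<in>F. \<integral>\<^sup>+t. v l t \<partial>\<mu> l)"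
    proof (intro prod.cong refl)
      fix l assume l: "l \<in> F"
      show "(\<integral>\<^sup>+t. (\<integral>\<^sup>+y. u l y \<partial>normal_law t \<sigma>) \<partial>\<mu> l) = (\<integral>\<^sup>+t. v l t \<partial>\<mu> l)"
      proof (cases "l = i")
        case True
        then show ?thesis
          using normal_posterior_disintegration[OF \<mu>(1)[OF i] \<mu>(2)[OF i] \<sigma> S B'[of i]]
          by (simp add: u_def v_def R_def)
      next
        case False
        then show ?thesis by (simp add: u_def v_def)
      qed
    qed
    also have "\<dots> = (\<integral>\<^sup>+\<theta>. (\<Prod>l\<in>F. v l (\<theta> l)) \<partial>PiM \<Lambda> \<mu>)"
    proof (rule nn_integral_PiM_prod[symmetric])
      show "v l \<in> borel_measurable (\<mu> l)" if "l \<in> F" for l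
        using v_meas[of l] \<mu>(2)[of l] that F by (simp add: subset_iff cong: measurable_cong_sets)
    qed (use F \<mu> in auto)
    also have "\<dots> = (\<integral>\<^sup>+\<theta>. emeasure (?P \<theta>) ?E * indicator A \<theta> \<partial>PiM \<Lambda> \<mu>)"
    proof (rule nn_integral_cong_AE, use full in eventually_elim)
      fix \<theta> assume \<theta>: "\<theta> \<in> ell2 \<Lambda>"
      have "?E = {y \<in> space (PiM \<Lambda> (\<lambda>i. normal_law (\<theta> i) \<sigma>)). \<forall>l\<in>F. y l \<in> B' l}"
        by (auto simp: F_def B'_def space_PiM)
      then have "emeasure (?P \<theta>) ?E = (\<Prod>l\<in>F. emeasure (normal_law (\<theta> l) \<sigma>) (B' l))"
        unfolding P_eq using F B' by (subst emeasure_PiM_coordinates[symmetric]) (auto intro: prob_normal)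
      moreover have "indicator A \<theta> = (\<Prod>l\<in>F. if l = i then indicator S (\<theta> l) else 1 :: ennreal)"
        using F \<theta> by (simp add: A_def indicator_def)
      ultimately show "(\<Prod>l\<in>F. v l (\<theta> l)) = emeasure (?P \<theta>) ?E * indicator A \<theta>"
        unfolding v_def by (simp only: prod.distrib)
    qed
    also have "\<dots> = (\<integral>\<^sup>+y. emeasure (Q y) A * indicator ?E y \<partial>m)"
      by (rule Q_int[OF E, symmetric])
    also have "\<dots> = emeasure (density m (\<lambda>y. emeasure (Q y) A)) ?E"
      using QA_meas E sets_m by (intro emeasure_density[symmetric]) (auto cong: measurable_cong_sets)
    finally show "emeasure (density m (\<lambda>y. emeasure (Q y) A)) ?E = emeasure (density m (\<lambda>y. R (y i))) ?E" ..
  qed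
  then have "AE y in m. emeasure (Q y) A = R (y i)"
    using QA_meas Ri_meas sets_m fin
    by (subst finite_density_unique[symmetric]) (auto simp: top_unique cong: measurable_cong_sets)
  moreover have "Measurable.pred ?O (\<lambda>y. emeasure (Q y) A = R (y i))"
  proof -
    have "Measurable.pred ?O (\<lambda>y. f y = h y)"
      if "f \<in> borel_measurable ?O" "h \<in> borel_measurable ?O" for f h :: "('i \<Rightarrow> real) \<Rightarrow> ennreal"
      using borel_measurable_eq[OF that] unfolding pred_def .
    from this[OF QA_meas Ri_meas] show ?thesis .
  qed
  ultimately have some: "AE \<theta> in \<pi>. AE y in ?P \<theta>. emeasure (Q y) A = R (y i)"
    unfolding m_def using AE_bind[OF P_meas] by simp
  have "\<exists>\<theta>\<in>space \<pi>. AE y in ?P \<theta>. emeasure (Q y) A = R (y i)"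
  proof (rule ccontr)
    assume none: "\<not> ?thesis"
    have "AE \<theta> in \<pi>. False"
      using some AE_space by eventually_elim (use none in auto)
    then show False by simp
  qed
  then obtain \<theta> where "\<theta> \<in> ell2 \<Lambda>" "AE y in ?P \<theta>. emeasure (Q y) A = R (y i)"
    using space_\<pi> by auto
  from white_noise_null_set_shift[OF n this(1) \<theta>\<^sub>0 this(2)]
  show ?thesis by (simp only: A_def R_def \<sigma>_def)
qed

text \<open>Coordinates outside \<open>F\<close> have a point mass at 0 as prior, hence as posterior, and contribute nothing;
  the remaining ones are finite in number.\<close>

lemma posterior_union_bound:
  fixes \<mu> :: "'i \<Rightarrow> real measure"
  assumes \<Lambda>: "countable \<Lambda>" and n: "1 \<le> n"
    and \<mu>: "\<And>i. i \<in> \<Lambda> \<Longrightarrow> prob_space (\<mu> i)" "\<And>i. i \<in> \<Lambda> \<Longrightarrow> sets (\<mu> i) = sets borel"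
    and F: "finite F" "F \<subseteq> \<Lambda>" "\<And>i. i \<in> \<Lambda> - F \<Longrightarrow> \<mu> i = return borel 0"
    and Q: "is_posterior (restrict_space (PiM \<Lambda> \<mu>) (ell2 \<Lambda>)) (observation_space \<Lambda>) (white_noise_model \<Lambda> n) Q"
    and S: "\<And>i. i \<in> \<Lambda> \<Longrightarrow> S i \<in> sets borel" "\<And>i. i \<in> \<Lambda> - F \<Longrightarrow> 0 \<notin> S i" and \<theta>\<^sub>0: "\<theta>\<^sub>0 \<in> ell2 \<Lambda>"
    and T: "T \<subseteq> (\<Union>i\<in>\<Lambda>. {\<theta> \<in> ell2 \<Lambda>. \<theta> i \<in> S i})"
  shows "(\<integral>\<^sup>+y. emeasure (Q y) T \<partial>white_noise_model \<Lambda> n \<theta>\<^sub>0) \<le>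
    (\<Sum>i\<in>F. \<integral>\<^sup>+y. normal_posterior (\<mu> i) (real n powr (- 1/2)) (S i) y \<partial>normal_law (\<theta>\<^sub>0 i) (real n powr (- 1/2)))"
proof -
  define \<sigma> where "\<sigma> = real n powr (- 1/2)"
  have \<sigma>: "0 < \<sigma>" using n by (simp add: \<sigma>_def)
  let ?P = "white_noise_model \<Lambda> n \<theta>\<^sub>0" and ?\<pi> = "restrict_space (PiM \<Lambda> \<mu>) (ell2 \<Lambda>)"
  define A where "A = (\<lambda>i. {\<theta> \<in> ell2 \<Lambda>. \<theta> i \<in> S i})"
  have sets_PiM: "sets (PiM \<Lambda> \<mu>) = sets (PiM \<Lambda> (\<lambda>_. borel :: real measure))" using \<mu>(2) by (intro sets_PiM_cong) auto
  have P_eq: "?P = PiM \<Lambda> (\<lambda>i. normal_law (\<theta>\<^sub>0 i) \<sigma>)"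
    unfolding \<sigma>_def by (rule white_noise_model_eq_PiM[OF n])
  have R_meas: "normal_posterior (\<mu> i) \<sigma> (S i) \<in> borel_measurable borel" if "i \<in> \<Lambda>" for i
    using that by (intro borel_measurable_normal_posterior \<mu> \<sigma> S)
  have Ri_meas: "(\<lambda>y. normal_posterior (\<mu> i) \<sigma> (S i) (y i)) \<in> borel_measurable ?P" if "i \<in> \<Lambda>" for i
    unfolding P_eq using that R_meas[OF that]
    by (intro measurable_compose[OF measurable_component_singleton[OF that]]) (simp cong: measurable_cong_sets)
  have A_sets: "A i \<in> sets ?\<pi>" if "i \<in> \<Lambda>" for i
  proof -
    have "A i = ell2 \<Lambda> \<inter> {\<theta> \<in> space (PiM \<Lambda> (\<lambda>_. borel)). \<theta> i \<in> S i}"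
      using sets.sets_into_space[OF ell2_sets[OF \<Lambda>]] by (auto simp: A_def)
    moreover have "{\<theta> \<in> space (PiM \<Lambda> (\<lambda>_. borel)). \<theta> i \<in> S i} \<in> sets (PiM \<Lambda> (\<lambda>_. borel))"
      using that S(1)[OF that] by (intro sets_Collect_single') auto
    ultimately show ?thesis unfolding sets_restrict_space sets_PiM by auto
  qed
  have full: "AE \<theta> in PiM \<Lambda> \<mu>. \<theta> \<in> ell2 \<Lambda>"
    by (rule AE_ell2_finite_support[OF \<Lambda> \<mu> F(1,3)])
  have "AE y in ?P. \<forall>i\<in>\<Lambda>. emeasure (Q y) (A i) = normal_posterior (\<mu> i) \<sigma> (S i) (y i)"
    unfolding A_def \<sigma>_def using is_posterior_coordinate[OF \<Lambda> n \<mu> full Q _ S(1) \<theta>\<^sub>0]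
    by (intro AE_ball_countable'[OF _ \<Lambda>]) blast
  moreover have "AE y in ?P. sets (Q y) = sets ?\<pi>"
  proof (rule AE_I2)
    fix y assume y: "y \<in> space ?P"
    then have "y \<in> space (observation_space \<Lambda>)"
      unfolding P_eq by (simp add: space_PiM observation_space_def)
    moreover have "Q \<in> observation_space \<Lambda> \<rightarrow>\<^sub>M prob_algebra ?\<pi>"
      using Q unfolding is_posterior_def by simp
    ultimately have "Q y \<in> space (prob_algebra ?\<pi>)" by (rule measurable_space[rotated])
    then show "sets (Q y) = sets ?\<pi>" by (simp add: space_prob_algebra)
  qed
  ultimately have "AE y in ?P. emeasure (Q y) T \<le> (\<Sum>i\<in>F. normal_posterior (\<mu> i) \<sigma> (S i) (y i))"
  proof eventually_elim
    fix y assume eq: "\<forall>i\<in>\<Lambda>. emeasure (Q y) (A i) = normal_posterior (\<mu> i) \<sigma> (S i) (y i)"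
      and sets: "sets (Q y) = sets ?\<pi>"
    have As: "A i \<in> sets (Q y)" if "i \<in> \<Lambda>" for i using A_sets[OF that] sets by simp
    have null: "(\<Union>i\<in>\<Lambda> - F. A i) \<in> null_sets (Q y)"
    proof (rule null_sets_UN')
      show "countable (\<Lambda> - F)" using \<Lambda> by auto
      show "A i \<in> null_sets (Q y)" if "i \<in> \<Lambda> - F" for i
        using that As eq F(3)[OF that] S(2)[OF that] S(1)[of i] normal_posterior_return_0[of "S i" \<sigma> "y i"]
        by (intro null_setsI) auto
    qed
    have fin: "(\<Union>i\<in>F. A i) \<in> sets (Q y)" using F As by auto
    have "emeasure (Q y) T \<le> emeasure (Q y) ((\<Union>i\<in>F. A i) \<union> (\<Union>i\<in>\<Lambda> - F. A i))"
      using T fin null by (intro emeasure_mono) (auto simp: A_def)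
    also have "\<dots> = emeasure (Q y) (\<Union>i\<in>F. A i)"
      by (rule emeasure_Un_null_set[OF fin null])
    also have "\<dots> \<le> (\<Sum>i\<in>F. emeasure (Q y) (A i))"
      using F As by (intro emeasure_subadditive_finite) auto
    also have "\<dots> = (\<Sum>i\<in>F. normal_posterior (\<mu> i) \<sigma> (S i) (y i))"
      using F eq by (intro sum.cong) auto
    finally show "emeasure (Q y) T \<le> (\<Sum>i\<in>F. normal_posterior (\<mu> i) \<sigma> (S i) (y i))" .
  qed
  then have "(\<integral>\<^sup>+y. emeasure (Q y) T \<partial>?P) \<le> (\<integral>\<^sup>+y. (\<Sum>i\<in>F. normal_posterior (\<mu> i) \<sigma> (S i) (y i)) \<partial>?P)"
    by (rule nn_integral_mono_AE)
  also have "\<dots> = (\<Sum>i\<in>F. \<integral>\<^sup>+y. normal_posterior (\<mu> i) \<sigma> (S i) (y i) \<partial>?P)"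
    using F Ri_meas by (intro nn_integral_sum) auto
  also have "\<dots> = (\<Sum>i\<in>F. \<integral>\<^sup>+y. normal_posterior (\<mu> i) \<sigma> (S i) y \<partial>normal_law (\<theta>\<^sub>0 i) \<sigma>)"
    unfolding P_eq using F R_meas
    by (intro sum.cong refl nn_integral_PiM_coordinate) (auto intro: prob_space_normal_law[OF \<sigma>] cong: measurable_cong_sets)
  finally show ?thesis by (simp add: \<sigma>_def)
qed

section \<open>Spike and slab posteriors on the real line\<close>

lemma nn_integral_spike_slab_law:
  assumes g [measurable]: "g \<in> borel_measurable borel" and f: "f \<in> borel_measurable borel"
  shows "(\<integral>\<^sup>+t. f t \<partial>spike_slab_law g w) =
    ennreal (1 - w) * f 0 + ennreal w * (\<integral>\<^sup>+t. ennreal (g t) * f t \<partial>lborel)"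
  using f
proof (induction rule: borel_measurable_induct)
  case (cong f h)
  then show ?case by simp
next
  case (set A)
  have [measurable]: "A \<in> sets borel" using set by simp
  have "(\<integral>\<^sup>+t. indicator A t \<partial>spike_slab_law g w) = emeasure (spike_slab_law g w) A"
    by (simp add: nn_integral_indicator)
  then show ?case
    by (simp add: emeasure_spike_slab_law emeasure_density)
next
  case (mult u c)
  have [measurable]: "u \<in> borel_measurable borel" by fact
  have "(\<integral>\<^sup>+t. c * u t \<partial>spike_slab_law g w) = c * (\<integral>\<^sup>+t. u t \<partial>spike_slab_law g w)"
    by (rule nn_integral_cmult) measurable
  moreover have "(\<integral>\<^sup>+t. ennreal (g t) * (c * u t) \<partial>lborel) = c * (\<integral>\<^sup>+t. ennreal (g t) * u t \<partial>lborel)"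
    by (subst nn_integral_cmult[symmetric]) (auto simp: mult_ac)
  ultimately show ?case using mult by (simp add: distrib_left mult_ac)
next
  case (add u v)
  have [measurable]: "u \<in> borel_measurable borel" "v \<in> borel_measurable borel" by fact+
  have "(\<integral>\<^sup>+t. v t + u t \<partial>spike_slab_law g w) = (\<integral>\<^sup>+t. v t \<partial>spike_slab_law g w) + (\<integral>\<^sup>+t. u t \<partial>spike_slab_law g w)"
    by (rule nn_integral_add) measurable
  moreover have "(\<integral>\<^sup>+t. ennreal (g t) * (v t + u t) \<partial>lborel) = (\<integral>\<^sup>+t. ennreal (g t) * v t \<partial>lborel) + (\<integral>\<^sup>+t. ennreal (g t) * u t \<partial>lborel)"
    by (subst nn_integral_add[symmetric]) (auto simp: distrib_left)
  ultimately show ?case using add by (simp add: distrib_left add_ac)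
next
  case (seq U)
  have [measurable]: "U i \<in> borel_measurable borel" for i by fact
  have inc: "incseq U" by fact
  have 1: "(\<integral>\<^sup>+t. (SUP i. U i) t \<partial>spike_slab_law g w) = (SUP i. \<integral>\<^sup>+t. U i t \<partial>spike_slab_law g w)"
    unfolding SUP_apply by (rule nn_integral_monotone_convergence_SUP[OF inc]) measurable
  have inc': "incseq (\<lambda>i t. ennreal (g t) * U i t)"
    using inc by (auto simp: incseq_def le_fun_def intro!: mult_left_mono)
  have 2: "(\<integral>\<^sup>+t. ennreal (g t) * (SUP i. U i) t \<partial>lborel) = (SUP i. \<integral>\<^sup>+t. ennreal (g t) * U i t \<partial>lborel)"
    unfolding SUP_apply SUP_mult_left_ennreal by (rule nn_integral_monotone_convergence_SUP[OF inc']) measurable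
  have "(SUP i. \<integral>\<^sup>+t. U i t \<partial>spike_slab_law g w) =
      (SUP i. ennreal (1 - w) * U i 0 + ennreal w * (\<integral>\<^sup>+t. ennreal (g t) * U i t \<partial>lborel))"
    using seq by simp
  also have "(SUP i. ennreal (1 - w) * U i 0 + ennreal w * (\<integral>\<^sup>+t. ennreal (g t) * U i t \<partial>lborel)) =
      (SUP i. ennreal (1 - w) * U i 0) + (SUP i. ennreal w * (\<integral>\<^sup>+t. ennreal (g t) * U i t \<partial>lborel))"
    using inc by (intro ennreal_SUP_add)
      (auto simp: incseq_def le_fun_def intro!: mult_left_mono nn_integral_mono)
  finally have "(SUP i. \<integral>\<^sup>+t. U i t \<partial>spike_slab_law g w) =
      (SUP i. ennreal (1 - w) * U i 0) + (SUP i. ennreal w * (\<integral>\<^sup>+t. ennreal (g t) * U i t \<partial>lborel))" .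
  moreover have "(SUP i. U i) 0 = (SUP i. U i 0)" by (simp add: image_comp)
  ultimately show ?case
    unfolding 1 2 by (simp add: SUP_mult_left_ennreal)
qed

lemma prob_space_spike_slab_law:
  assumes "g \<in> borel_measurable borel" "(\<integral>\<^sup>+x. ennreal (g x) \<partial>lborel) = 1" "0 \<le> w" "w \<le> 1"
  shows "prob_space (spike_slab_law g w)"
proof
  have "emeasure (spike_slab_law g w) (space (spike_slab_law g w)) = (\<integral>\<^sup>+t. 1 \<partial>spike_slab_law g w)"
    by simp
  also have "\<dots> = ennreal (1 - w) + ennreal w"
    using nn_integral_spike_slab_law[OF assms(1), of "\<lambda>_. 1" w] assms(2) by simp
  also have "\<dots> = 1" using assms by (simp flip: ennreal_plus)
  finally show "emeasure (spike_slab_law g w) (space (spike_slab_law g w)) = 1" .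
qed

text \<open>On the tail, half of the Gaussian exponent pays for the factor \<open>exp (- x\<^sup>2 / 4)\<close>; the other half leaves
  a normal density with doubled variance. Integrating this inequality gives a tail bound.\<close>

lemma normal_tail_density:
  assumes \<sigma>: "0 < \<sigma>" and x: "0 \<le> x" "x * \<sigma> \<le> \<bar>y - a\<bar>"
  shows "normal_density a \<sigma> y \<le> sqrt 2 * exp (- x\<^sup>2 / 4) * normal_density a (sqrt 2 * \<sigma>) y"
proof -
  have "(x * \<sigma>)\<^sup>2 \<le> (y - a)\<^sup>2" using x \<sigma> by (simp add: abs_le_square_iff[symmetric])
  then have "x\<^sup>2 \<le> (y - a)\<^sup>2 / \<sigma>\<^sup>2" using \<sigma> by (simp add: le_divide_eq power_mult_distrib)
  moreover have "(y - a)\<^sup>2 / (2 * \<sigma>\<^sup>2) = (y - a)\<^sup>2 / \<sigma>\<^sup>2 / 2" "(y - a)\<^sup>2 / (4 * \<sigma>\<^sup>2) = (y - a)\<^sup>2 / \<sigma>\<^sup>2 / 4"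
    by simp_all
  ultimately have "- (y - a)\<^sup>2 / (2 * \<sigma>\<^sup>2) \<le> - x\<^sup>2 / 4 + - (y - a)\<^sup>2 / (4 * \<sigma>\<^sup>2)"
    by linarith
  then have "exp (- (y - a)\<^sup>2 / (2 * \<sigma>\<^sup>2)) \<le> exp (- x\<^sup>2 / 4) * exp (- (y - a)\<^sup>2 / (4 * \<sigma>\<^sup>2))"
    by (simp flip: exp_add)
  then have "1 / sqrt (2 * pi * \<sigma>\<^sup>2) * exp (- (y - a)\<^sup>2 / (2 * \<sigma>\<^sup>2)) \<le>
      1 / sqrt (2 * pi * \<sigma>\<^sup>2) * (exp (- x\<^sup>2 / 4) * exp (- (y - a)\<^sup>2 / (4 * \<sigma>\<^sup>2)))"
    by (rule mult_left_mono) simp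
  then have "normal_density a \<sigma> y \<le> exp (- x\<^sup>2 / 4) * (1 / sqrt (2 * pi * \<sigma>\<^sup>2) * exp (- (y - a)\<^sup>2 / (4 * \<sigma>\<^sup>2)))"
    by (simp only: normal_density_def mult_ac)
  also have "1 / sqrt (2 * pi * \<sigma>\<^sup>2) * exp (- (y - a)\<^sup>2 / (4 * \<sigma>\<^sup>2)) = sqrt 2 * normal_density a (sqrt 2 * \<sigma>) y"
  proof -
    have "sqrt (2 * pi * (sqrt 2 * \<sigma>)\<^sup>2) = sqrt 2 * sqrt (2 * pi * \<sigma>\<^sup>2)"
      by (simp add: power_mult_distrib mult_ac flip: real_sqrt_mult)
    moreover have "2 * (sqrt 2 * \<sigma>)\<^sup>2 = 4 * \<sigma>\<^sup>2" by (simp add: power_mult_distrib)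
    ultimately show ?thesis unfolding normal_density_def by simp
  qed
  finally show ?thesis by (simp only: mult_ac)
qed

text \<open>Splits off the event that the noise exceeds \<open>x\<close> standard deviations, where the integrand is bounded
  by 1.\<close>

lemma nn_integral_normal_law_truncate:
  assumes \<sigma>: "0 < \<sigma>" and x: "0 \<le> x" and f [measurable]: "f \<in> borel_measurable borel" and f1: "\<And>y. f y \<le> 1"
    and h [measurable]: "h \<in> borel_measurable borel"
    and bound: "\<And>y. \<bar>y - a\<bar> \<le> x * \<sigma> \<Longrightarrow> ennreal (normal_density a \<sigma> y) * f y \<le> h y"
  shows "(\<integral>\<^sup>+y. f y \<partial>normal_law a \<sigma>) \<le> ennreal (sqrt 2 * exp (- x\<^sup>2 / 4)) + (\<integral>\<^sup>+y. h y * indicator {a - x * \<sigma>..a + x * \<sigma>} y \<partial>lborel)"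
proof -
  have \<sigma>2: "0 < sqrt 2 * \<sigma>" using \<sigma> by simp
  have "(\<integral>\<^sup>+y. f y \<partial>normal_law a \<sigma>) = (\<integral>\<^sup>+y. ennreal (normal_density a \<sigma> y) * f y \<partial>lborel)"
    by (rule nn_integral_normal_law[OF f])
  also have "\<dots> \<le> (\<integral>\<^sup>+y. ennreal (sqrt 2 * exp (- x\<^sup>2 / 4)) * ennreal (normal_density a (sqrt 2 * \<sigma>) y)
      + h y * indicator {a - x * \<sigma>..a + x * \<sigma>} y \<partial>lborel)"
  proof (intro nn_integral_mono)
    fix y
    show "ennreal (normal_density a \<sigma> y) * f y \<le> ennreal (sqrt 2 * exp (- x\<^sup>2 / 4)) * ennreal (normal_density a (sqrt 2 * \<sigma>) y)
      + h y * indicator {a - x * \<sigma>..a + x * \<sigma>} y"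
    proof (cases "\<bar>y - a\<bar> \<le> x * \<sigma>")
      case True
      then have "y \<in> {a - x * \<sigma>..a + x * \<sigma>}" by auto
      then show ?thesis using bound[OF True] by (simp add: add_increasing)
    next
      case False
      have "ennreal (normal_density a \<sigma> y) * f y \<le> ennreal (normal_density a \<sigma> y) * 1"
        by (intro mult_left_mono f1) auto
      also have "\<dots> \<le> ennreal (sqrt 2 * exp (- x\<^sup>2 / 4) * normal_density a (sqrt 2 * \<sigma>) y)"
        using normal_tail_density[OF \<sigma> x, of y a] False by (simp add: ennreal_leI)
      also have "\<dots> = ennreal (sqrt 2 * exp (- x\<^sup>2 / 4)) * ennreal (normal_density a (sqrt 2 * \<sigma>) y)"
        by (rule ennreal_mult) auto
      finally show ?thesis by (simp add: add_increasing2)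
    qed
  qed
  also have "\<dots> = ennreal (sqrt 2 * exp (- x\<^sup>2 / 4)) * (\<integral>\<^sup>+y. ennreal (normal_density a (sqrt 2 * \<sigma>) y) \<partial>lborel)
      + (\<integral>\<^sup>+y. h y * indicator {a - x * \<sigma>..a + x * \<sigma>} y \<partial>lborel)"
    by (simp add: nn_integral_add nn_integral_cmult)
  finally show ?thesis by (simp add: nn_integral_normal_density[OF \<sigma>2])
qed

lemma ennreal_divide_le:
  assumes "N \<le> ennreal u" "ennreal d \<le> D" "0 < d" "0 \<le> u"
  shows "N / D \<le> ennreal (u / d)"
proof -
  have "inverse D \<le> inverse (ennreal d)"
    using assms by (cases D) (auto simp: inverse_ennreal intro!: ennreal_leI le_imp_inverse_le)
  then have "N / D \<le> ennreal u / ennreal d"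
    unfolding divide_ennreal_def using assms by (intro mult_mono) auto
  then show ?thesis using assms by (simp add: divide_ennreal)
qed

lemma nn_integral_interval_const:
  "0 \<le> r \<Longrightarrow> 0 \<le> c \<Longrightarrow> (\<integral>\<^sup>+t. ennreal c * indicator {a - r..a + r} t \<partial>lborel) = ennreal (2 * r * c)"
  by (simp add: nn_integral_cmult_indicator mult_ac flip: ennreal_mult)

text \<open>Suppose that the noise is at most \<open>x\<close> standard deviations. A parameter at distance more than
  \<open>4 x \<sigma>\<close> from \<open>a\<close> is at distance at least \<open>3 x \<sigma>\<close> from the observation, so its likelihood is at
  most a constant times \<open>exp (- 9 x\<^sup>2 / 2)\<close>. The slab alone contributes to the denominator the
  interval of radius \<open>\<sigma>\<close> about \<open>a\<close>, of mass at least \<open>2 w c \<sigma>\<close>, where the likelihood is at least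
  the same constant times \<open>exp (- 2 x\<^sup>2)\<close>.\<close>

lemma posterior_far_from_truth:
  assumes g: "g \<in> borel_measurable borel" "(\<integral>\<^sup>+x. ennreal (g x) \<partial>lborel) = 1"
    and \<sigma>: "0 < \<sigma>" and w: "0 < w" "w \<le> 1"
    and c: "0 < c" "\<And>t. t \<in> {a - \<sigma>..a + \<sigma>} \<Longrightarrow> c \<le> g t" and x: "1 \<le> x"
  shows "(\<integral>\<^sup>+y. normal_posterior (spike_slab_law g w) \<sigma> {t. 4 * x * \<sigma> < \<bar>t - a\<bar>} y \<partial>normal_law a \<sigma>) \<le>
    ennreal (sqrt 2 * exp (- x\<^sup>2 / 4) + exp (- 5 * x\<^sup>2 / 2) / (2 * w * c * \<sigma>))"
proof -
  let ?\<mu> = "spike_slab_law g w" and ?S = "{t. 4 * x * \<sigma> < \<bar>t - a\<bar>}"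
  interpret \<mu>: prob_space ?\<mu> using w by (intro prob_space_spike_slab_law g) auto
  note [measurable] = g(1)
  have S [measurable]: "?S \<in> sets borel" by measurable
  define \<kappa> where "\<kappa> = 1 / sqrt (2 * pi * \<sigma>\<^sup>2)"
  have \<kappa>: "0 < \<kappa>" using \<sigma> by (simp add: \<kappa>_def)
  have nd: "normal_density t \<sigma> y = \<kappa> * exp (- (y - t)\<^sup>2 / (2 * \<sigma>\<^sup>2))" for t y
    by (simp add: normal_density_def \<kappa>_def)
  have near: "normal_posterior ?\<mu> \<sigma> ?S y \<le> ennreal (exp (- 5 * x\<^sup>2 / 2) / (2 * w * c * \<sigma>))"
    if y: "\<bar>y - a\<bar> \<le> x * \<sigma>" for y
  proof -
    have N: "(\<integral>\<^sup>+t. ennreal (normal_density t \<sigma> y) * indicator ?S t \<partial>?\<mu>) \<le> ennreal (\<kappa> * exp (- 9 * x\<^sup>2 / 2))"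
    proof -
      have "(\<integral>\<^sup>+t. ennreal (normal_density t \<sigma> y) * indicator ?S t \<partial>?\<mu>) \<le> (\<integral>\<^sup>+t. ennreal (\<kappa> * exp (- 9 * x\<^sup>2 / 2)) \<partial>?\<mu>)"
      proof (intro nn_integral_mono)
        fix t
        have "normal_density t \<sigma> y \<le> \<kappa> * exp (- 9 * x\<^sup>2 / 2)" if "t \<in> ?S"
        proof -
          have "\<bar>3 * x * \<sigma>\<bar> \<le> \<bar>y - t\<bar>" using that y x \<sigma> by (simp add: abs_mult)
          then have "(3 * x * \<sigma>)\<^sup>2 \<le> (y - t)\<^sup>2" by (simp only: abs_le_square_iff)
          then have "- (y - t)\<^sup>2 / (2 * \<sigma>\<^sup>2) \<le> - 9 * x\<^sup>2 / 2"
            using \<sigma> by (simp add: field_simps power2_eq_square)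
          then show ?thesis using \<kappa> by (simp add: nd)
        qed
        then show "ennreal (normal_density t \<sigma> y) * indicator ?S t \<le> ennreal (\<kappa> * exp (- 9 * x\<^sup>2 / 2))"
          by (auto simp: indicator_def intro: ennreal_leI)
      qed
      then show ?thesis by (simp add: \<mu>.emeasure_space_1[simplified])
    qed
    have D: "ennreal (2 * w * c * \<sigma> * \<kappa> * exp (- 2 * x\<^sup>2)) \<le> (\<integral>\<^sup>+t. ennreal (normal_density t \<sigma> y) \<partial>?\<mu>)"
    proof -
      have "ennreal (2 * w * c * \<sigma> * \<kappa> * exp (- 2 * x\<^sup>2)) = ennreal w * ennreal (2 * \<sigma> * (c * (\<kappa> * exp (- 2 * x\<^sup>2))))"
        using w \<sigma> c \<kappa> by (simp add: mult_ac flip: ennreal_mult)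
      also have "ennreal (2 * \<sigma> * (c * (\<kappa> * exp (- 2 * x\<^sup>2)))) =
          (\<integral>\<^sup>+t. ennreal (c * (\<kappa> * exp (- 2 * x\<^sup>2))) * indicator {a - \<sigma>..a + \<sigma>} t \<partial>lborel)"
        using \<sigma> c \<kappa> by (intro nn_integral_interval_const[symmetric]) auto
      also have "\<dots> \<le> (\<integral>\<^sup>+t. ennreal (g t) * ennreal (normal_density t \<sigma> y) \<partial>lborel)"
      proof (intro nn_integral_mono)
        fix t
        have "c * (\<kappa> * exp (- 2 * x\<^sup>2)) \<le> g t * normal_density t \<sigma> y" if t: "t \<in> {a - \<sigma>..a + \<sigma>}"
        proof (rule mult_mono)
          have "\<bar>y - t\<bar> \<le> x * \<sigma> + \<sigma>" using t y by auto
          also have "\<dots> \<le> x * \<sigma> + x * \<sigma>" using x \<sigma> by simp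
          finally have "\<bar>y - t\<bar> \<le> \<bar>2 * x * \<sigma>\<bar>" using x \<sigma> by (simp add: abs_mult mult_ac)
          then have "(y - t)\<^sup>2 \<le> (2 * x * \<sigma>)\<^sup>2" by (simp only: abs_le_square_iff)
          then have "- 2 * x\<^sup>2 \<le> - (y - t)\<^sup>2 / (2 * \<sigma>\<^sup>2)"
            using \<sigma> by (simp add: field_simps power2_eq_square)
          then show "\<kappa> * exp (- 2 * x\<^sup>2) \<le> normal_density t \<sigma> y" using \<kappa> by (simp add: nd)
          show "c \<le> g t" by (rule c(2)[OF t])
          show "0 \<le> g t" using c(1) c(2)[OF t] by simp
        qed (use \<kappa> in auto)
        then show "ennreal (c * (\<kappa> * exp (- 2 * x\<^sup>2))) * indicator {a - \<sigma>..a + \<sigma>} t \<le> ennreal (g t) * ennreal (normal_density t \<sigma> y)"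
          by (auto simp: indicator_def ennreal_leI simp flip: ennreal_mult'')
      qed
      also have "ennreal w * \<dots> \<le> (\<integral>\<^sup>+t. ennreal (normal_density t \<sigma> y) \<partial>?\<mu>)"
        by (subst nn_integral_spike_slab_law[OF g(1)]) (auto simp: add_increasing)
      finally show ?thesis by (simp add: mult_left_mono)
    qed
    have "normal_posterior ?\<mu> \<sigma> ?S y \<le> ennreal ((\<kappa> * exp (- 9 * x\<^sup>2 / 2)) / (2 * w * c * \<sigma> * \<kappa> * exp (- 2 * x\<^sup>2)))"
      unfolding normal_posterior_def using \<kappa> w c \<sigma> by (intro ennreal_divide_le[OF N D]) auto
    also have "(\<kappa> * exp (- 9 * x\<^sup>2 / 2)) / (2 * w * c * \<sigma> * \<kappa> * exp (- 2 * x\<^sup>2)) =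
        (exp (- 9 * x\<^sup>2 / 2) / exp (- 2 * x\<^sup>2)) / (2 * w * c * \<sigma>)"
      using \<kappa> by simp
    also have "exp (- 9 * x\<^sup>2 / 2) / exp (- 2 * x\<^sup>2) = exp (- 5 * x\<^sup>2 / 2)"
      by (simp add: field_simps flip: exp_diff)
    finally show ?thesis .
  qed
  let ?b = "exp (- 5 * x\<^sup>2 / 2) / (2 * w * c * \<sigma>)"
  have "(\<integral>\<^sup>+y. normal_posterior ?\<mu> \<sigma> ?S y \<partial>normal_law a \<sigma>) \<le> ennreal (sqrt 2 * exp (- x\<^sup>2 / 4))
      + (\<integral>\<^sup>+y. (ennreal (normal_density a \<sigma> y) * ennreal ?b) * indicator {a - x * \<sigma>..a + x * \<sigma>} y \<partial>lborel)"
    using x near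
    by (intro nn_integral_normal_law_truncate[OF \<sigma>] borel_measurable_normal_posterior normal_posterior_le_1)
      (auto intro!: \<mu>.prob_space_axioms \<sigma> mult_left_mono)
  also have "(\<integral>\<^sup>+y. (ennreal (normal_density a \<sigma> y) * ennreal ?b) * indicator {a - x * \<sigma>..a + x * \<sigma>} y \<partial>lborel)
      \<le> (\<integral>\<^sup>+y. ennreal (normal_density a \<sigma> y) * ennreal ?b \<partial>lborel)"
    by (intro nn_integral_mono) (auto simp: indicator_def)
  also have "\<dots> = ennreal ?b"
    by (subst nn_integral_multc) (auto simp: nn_integral_normal_density[OF \<sigma>])
  finally show ?thesis using w c \<sigma> by (simp add: add_left_mono ennreal_plus)
qed

text \<open>The slab likelihood is at most \<open>G\<close> because the normal density is symmetric in mean and argument, and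
  the spike has prior mass at least 1/2, so the posterior odds of the slab are at most \<open>2 w G\<close> divided
  by the density of the observation under the spike. Averaged over an observation with mean \<open>a\<close>, this
  leaves the likelihood ratio of \<open>a\<close> against 0. The ratio is at most
  \<open>exp (h\<^sup>2 / 2 + h x)\<close> on the event that the noise is at most \<open>x\<close> standard deviations, an interval of
  length \<open>2 x \<sigma>\<close>. The truncation is essential: without it this
  bound integrates to infinity.\<close>

lemma posterior_slab_small_signal:
  assumes g: "g \<in> borel_measurable borel" "(\<integral>\<^sup>+x. ennreal (g x) \<partial>lborel) = 1" "\<And>t. g t \<le> G"
    and \<sigma>: "0 < \<sigma>" and w: "0 \<le> w" "w \<le> 1 / 2" and G: "0 \<le> G"
    and a: "\<bar>a\<bar> \<le> h * \<sigma>" and x: "0 \<le> x"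
  shows "(\<integral>\<^sup>+y. normal_posterior (spike_slab_law g w) \<sigma> (- {0}) y \<partial>normal_law a \<sigma>) \<le>
    ennreal (sqrt 2 * exp (- x\<^sup>2 / 4) + 4 * w * G * x * \<sigma> * exp (h\<^sup>2 / 2 + h * x))"
proof -
  let ?\<mu> = "spike_slab_law g w"
  interpret \<mu>: prob_space ?\<mu> using w by (intro prob_space_spike_slab_law g) auto
  note [measurable] = g(1)
  have h: "0 \<le> h" using a \<sigma> by (meson abs_ge_zero order_trans zero_le_mult_iff not_less)
  have post: "normal_posterior ?\<mu> \<sigma> (- {0}) y \<le> ennreal (w * G / (normal_density 0 \<sigma> y / 2))" for y
    unfolding normal_posterior_def
  proof (rule ennreal_divide_le)
    have "(\<integral>\<^sup>+t. ennreal (normal_density t \<sigma> y) * indicator (- {0}) t \<partial>?\<mu>) =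
        ennreal w * (\<integral>\<^sup>+t. ennreal (g t) * (ennreal (normal_density t \<sigma> y) * indicator (- {0}) t) \<partial>lborel)"
      by (subst nn_integral_spike_slab_law[OF g(1)]) auto
    also have "\<dots> \<le> ennreal w * (\<integral>\<^sup>+t. ennreal G * ennreal (normal_density y \<sigma> t) \<partial>lborel)"
    proof (intro mult_left_mono nn_integral_mono mult_mono)
      show "ennreal (normal_density t \<sigma> y) * indicator (- {0}) t \<le> ennreal (normal_density y \<sigma> t)" for t
        by (auto simp: indicator_def normal_density_def power2_commute)
    qed (auto intro: ennreal_leI g)
    also have "\<dots> = ennreal (w * G)"
      using w G by (simp add: nn_integral_cmult nn_integral_normal_density[OF \<sigma>] ennreal_mult)
    finally show "(\<integral>\<^sup>+t. ennreal (normal_density t \<sigma> y) * indicator (- {0}) t \<partial>?\<mu>) \<le> ennreal (w * G)" .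
    have "ennreal (normal_density 0 \<sigma> y / 2) \<le> ennreal (1 - w) * ennreal (normal_density 0 \<sigma> y)"
      using w mult_right_mono[of "1/2" "1 - w" "normal_density 0 \<sigma> y"] by (simp add: ennreal_leI flip: ennreal_mult)
    also have "\<dots> \<le> (\<integral>\<^sup>+t. ennreal (normal_density t \<sigma> y) \<partial>?\<mu>)"
      by (subst nn_integral_spike_slab_law[OF g(1)]) auto
    finally show "ennreal (normal_density 0 \<sigma> y / 2) \<le> (\<integral>\<^sup>+t. ennreal (normal_density t \<sigma> y) \<partial>?\<mu>)" .
  qed (use w G normal_density_pos[OF \<sigma>] in auto)
  let ?b = "2 * w * G * exp (h\<^sup>2 / 2 + h * x)"
  have "(\<integral>\<^sup>+y. normal_posterior ?\<mu> \<sigma> (- {0}) y \<partial>normal_law a \<sigma>) \<le> ennreal (sqrt 2 * exp (- x\<^sup>2 / 4))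
      + (\<integral>\<^sup>+y. ennreal ?b * indicator {a - x * \<sigma>..a + x * \<sigma>} y \<partial>lborel)"
  proof (rule nn_integral_normal_law_truncate[OF \<sigma> x _ normal_posterior_le_1])
    show "normal_posterior ?\<mu> \<sigma> (- {0}) \<in> borel_measurable borel"
      by (intro borel_measurable_normal_posterior \<mu>.prob_space_axioms \<sigma>) auto
    fix y assume y: "\<bar>y - a\<bar> \<le> x * \<sigma>"
    have "(y - 0)\<^sup>2 - (y - a)\<^sup>2 = a\<^sup>2 + 2 * (a * (y - a))"
      by (simp add: power2_eq_square algebra_simps)
    also have "\<dots> \<le> (h * \<sigma>)\<^sup>2 + 2 * ((h * \<sigma>) * (x * \<sigma>))"
    proof (intro add_mono mult_left_mono)
      show "a\<^sup>2 \<le> (h * \<sigma>)\<^sup>2" using a by (simp add: abs_le_square_iff[symmetric] abs_le_iff)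
      have "a * (y - a) \<le> \<bar>a\<bar> * \<bar>y - a\<bar>" by (metis abs_ge_self abs_mult)
      also have "\<dots> \<le> (h * \<sigma>) * (x * \<sigma>)" using a y h \<sigma> by (intro mult_mono) auto
      finally show "a * (y - a) \<le> (h * \<sigma>) * (x * \<sigma>)" .
    qed simp
    also have "\<dots> = (h\<^sup>2 / 2 + h * x) * (2 * \<sigma>\<^sup>2)" by (simp add: power2_eq_square algebra_simps)
    finally have "((y - 0)\<^sup>2 - (y - a)\<^sup>2) / (2 * \<sigma>\<^sup>2) \<le> h\<^sup>2 / 2 + h * x"
      using \<sigma> by (simp add: divide_le_eq)
    then have ratio: "normal_density a \<sigma> y / normal_density 0 \<sigma> y \<le> exp (h\<^sup>2 / 2 + h * x)"
      unfolding normal_density_ratio[OF \<sigma>] by simp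
    have "ennreal (normal_density a \<sigma> y) * normal_posterior ?\<mu> \<sigma> (- {0}) y \<le>
        ennreal (normal_density a \<sigma> y) * ennreal (w * G / (normal_density 0 \<sigma> y / 2))"
      by (intro mult_left_mono post) auto
    also have "\<dots> = ennreal (2 * w * G * (normal_density a \<sigma> y / normal_density 0 \<sigma> y))"
      using w G by (simp add: mult_ac flip: ennreal_mult)
    also have "\<dots> \<le> ennreal ?b"
      using ratio w G by (intro ennreal_leI mult_left_mono) auto
    finally show "ennreal (normal_density a \<sigma> y) * normal_posterior ?\<mu> \<sigma> (- {0}) y \<le> ennreal ?b" .
  qed auto
  also have "(\<integral>\<^sup>+y. ennreal ?b * indicator {a - x * \<sigma>..a + x * \<sigma>} y \<partial>lborel) = ennreal (2 * (x * \<sigma>) * ?b)"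
    using x \<sigma> w G by (intro nn_integral_interval_const) auto
  also have "ennreal (sqrt 2 * exp (- x\<^sup>2 / 4)) + \<dots> = ennreal (sqrt 2 * exp (- x\<^sup>2 / 4) + 2 * (x * \<sigma>) * ?b)"
    using x \<sigma> w G by (intro ennreal_plus[symmetric]) auto
  finally show ?thesis by (simp add: mult_ac)
qed

section \<open>Loss, levels and rates\<close>

text \<open>A growing geometric sum is comparable with its last term; the induction carries the sharper bound by
  \<open>min (q Z) (q\<^sup>m) / (q - 1)\<close>.\<close>

lemma geometric_sum_below:
  fixes q Z :: real
  assumes q: "1 < q" and Z: "0 \<le> Z"
  shows "(\<Sum>j<m. if q ^ j \<le> Z then q ^ j else 0) \<le> q / (q - 1) * Z"
proof -
  have "(\<Sum>j<m. if q ^ j \<le> Z then q ^ j else 0) \<le> min (q * Z) (q ^ m) / (q - 1)"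
  proof (induction m)
    case 0
    then show ?case using q Z by simp
  next
    case (Suc m)
    show ?case
    proof (cases "q ^ m \<le> Z")
      case True
      have "(\<Sum>j<Suc m. if q ^ j \<le> Z then q ^ j else 0) \<le> q ^ m / (q - 1) + q ^ m"
        using Suc True q divide_right_mono[OF min.cobounded2[of "q * Z" "q ^ m"], of "q - 1"] by simp
      also have "\<dots> = q ^ Suc m / (q - 1)" using q by (simp add: field_simps)
      also have "q ^ Suc m = min (q * Z) (q ^ Suc m)" using True q by simp
      finally show ?thesis .
    next
      case False
      have "min (q * Z) (q ^ m) \<le> min (q * Z) (q ^ Suc m)"
        using q power_increasing[of m "Suc m" q] by (intro min.mono) auto
      then have "min (q * Z) (q ^ m) / (q - 1) \<le> min (q * Z) (q ^ Suc m) / (q - 1)"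
        using q by (intro divide_right_mono) auto
      then show ?thesis using Suc False by simp
    qed
  qed
  also have "\<dots> \<le> q * Z / (q - 1)" using q by (intro divide_right_mono) auto
  finally show ?thesis by simp
qed

text \<open>A decaying geometric sum is comparable with its first term; the induction carries the bound
  \<open>(Z - min Z (r\<^sup>m)) / (1 - r)\<close>, which leaves room for the terms still to come.\<close>

lemma geometric_sum_tail:
  fixes r Z :: real
  assumes r: "0 < r" "r < 1" and Z: "0 \<le> Z"
  shows "(\<Sum>j<m. if r ^ j \<le> Z then r ^ j else 0) \<le> Z / (1 - r)"
proof -
  have "(\<Sum>j<m. if r ^ j \<le> Z then r ^ j else 0) \<le> (Z - min Z (r ^ m)) / (1 - r)"
  proof (induction m)
    case 0
    then show ?case using r Z by simp
  next
    case (Suc m)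
    show ?case
    proof (cases "r ^ m \<le> Z")
      case True
      have "(\<Sum>j<Suc m. if r ^ j \<le> Z then r ^ j else 0) \<le> (Z - r ^ m) / (1 - r) + r ^ m"
        using Suc True by (simp add: min_absorb2)
      also have "\<dots> = (Z - r ^ Suc m) / (1 - r)" using r by (simp add: field_simps)
      also have "r ^ Suc m = min Z (r ^ Suc m)"
      proof -
        have "r ^ Suc m \<le> r ^ m" using r by (intro power_decreasing) auto
        then have "r ^ Suc m \<le> Z" using True by linarith
        then show ?thesis by (simp only: min_absorb2)
      qed
      finally show ?thesis .
    next
      case False
      then have "(\<Sum>j<Suc m. if r ^ j \<le> Z then r ^ j else 0) \<le> 0" using Suc by (simp add: min_absorb1)
      also have "\<dots> \<le> (Z - min Z (r ^ Suc m)) / (1 - r)" using r by simp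
      finally show ?thesis .
    qed
  qed
  also have "\<dots> \<le> Z / (1 - r)" using r Z by (intro divide_right_mono) auto
  finally show ?thesis .
qed

text \<open>The levels in \<open>E\<close> contribute at most \<open>2\<^bsup>j/2\<^esup> \<delta>\<close>, the others at most \<open>L 2\<^bsup>-j\<beta>\<^esup>\<close> by smoothness of
  \<open>\<theta>\<^sub>0\<close>. Since \<open>2\<^sup>j \<le> Y\<close> on \<open>E\<close> and \<open>Z \<le> 2\<^sup>j\<close> off it, these are the two geometric sums above with
  ratios \<open>\<surd>2\<close> and \<open>2\<^bsup>-\<beta>\<^esup>\<close>.\<close>

lemma loss_inf_le:
  assumes I: "\<And>j. finite (I j)" "\<And>j. I j \<noteq> {}"
    and \<beta>: "0 < \<beta>" and L: "0 \<le> L" and \<delta>: "0 \<le> \<delta>" and Y: "0 < Y" "0 < Z"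
    and near: "\<And>j k. j \<in> E \<Longrightarrow> k \<in> I j \<Longrightarrow> \<bar>\<theta> (j, k) - \<theta>\<^sub>0 (j, k)\<bar> \<le> \<delta>"
    and E: "\<And>j. j \<in> E \<Longrightarrow> 2 ^ j \<le> Y"
    and zero: "\<And>j k. j \<notin> E \<Longrightarrow> k \<in> I j \<Longrightarrow> \<theta> (j, k) = 0"
    and smooth: "\<And>j k. j \<notin> E \<Longrightarrow> k \<in> I j \<Longrightarrow> \<bar>\<theta>\<^sub>0 (j, k)\<bar> \<le> L * 2 powr (- (real j * (\<beta> + 1/2)))"
    and E': "\<And>j. j \<notin> E \<Longrightarrow> Z \<le> 2 ^ j"
  shows "loss_inf I \<theta> \<theta>\<^sub>0 \<le> ennreal (4 * sqrt Y * \<delta> + L * (Z powr (- \<beta>) / (1 - 2 powr (- \<beta>))))"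
  unfolding loss_inf_def
proof (rule suminf_le_const)
  fix m
  let ?a = "\<lambda>j. 2 powr (real j / 2) * (MAX k\<in>I j. \<bar>\<theta> (j, k) - \<theta>\<^sub>0 (j, k)\<bar>)"
  define b where "b = (\<lambda>j. if sqrt 2 ^ j \<le> sqrt Y then sqrt 2 ^ j else 0)"
  define c where "c = (\<lambda>j. if (2 powr (- \<beta>)) ^ j \<le> Z powr (- \<beta>) then (2 powr (- \<beta>)) ^ j else 0)"
  have half: "2 powr (real j / 2) = sqrt 2 ^ j" for j
    by (simp add: powr_half_sqrt[symmetric] powr_realpow[symmetric] powr_powr)
  have bc: "0 \<le> b j" "0 \<le> c j" for j by (auto simp: b_def c_def)
  have a_le: "?a j \<le> \<delta> * b j + L * c j" for j
  proof (cases "j \<in> E")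
    case True
    have "(MAX k\<in>I j. \<bar>\<theta> (j, k) - \<theta>\<^sub>0 (j, k)\<bar>) \<le> \<delta>"
      using I near[OF True] by (intro Max.boundedI) auto
    then have "?a j \<le> sqrt 2 ^ j * \<delta>" by (simp add: half mult_left_mono)
    moreover have "b j = sqrt 2 ^ j"
      using E[OF True] by (simp add: b_def flip: real_sqrt_power)
    moreover have "0 \<le> L * c j" using L bc by simp
    ultimately show ?thesis by (simp add: mult_ac)
  next
    case False
    have "(MAX k\<in>I j. \<bar>\<theta> (j, k) - \<theta>\<^sub>0 (j, k)\<bar>) \<le> L * 2 powr (- (real j * (\<beta> + 1/2)))"
      using I zero[OF False] smooth[OF False] by (intro Max.boundedI) auto
    then have "?a j \<le> 2 powr (real j / 2) * (L * 2 powr (- (real j * (\<beta> + 1/2))))"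
      by (intro mult_left_mono) auto
    also have "\<dots> = L * 2 powr (- (real j * \<beta>))"
      by (simp add: mult.left_commute[of _ L] powr_add[symmetric] algebra_simps)
    also have "2 powr (- (real j * \<beta>)) = (2 powr (- \<beta>)) ^ j"
      by (simp add: powr_realpow[symmetric] powr_powr mult_ac)
    also have "\<dots> = c j"
    proof -
      have "(2 powr (- \<beta>)) ^ j = (2 ^ j) powr (- \<beta>)"
        by (simp add: powr_realpow[symmetric] powr_powr mult_ac)
      also have "\<dots> \<le> Z powr (- \<beta>)" using E'[OF False] Y \<beta> by (intro powr_mono2') auto
      finally show ?thesis by (simp add: c_def)
    qed
    finally show ?thesis using \<delta> bc(1)[of j] by (simp add: add_increasing)
  qed
  have a_nn: "0 \<le> ?a j" for j
  proof -
    obtain k where "k \<in> I j" using I(2) by auto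
    then have "0 \<le> (MAX k\<in>I j. \<bar>\<theta> (j, k) - \<theta>\<^sub>0 (j, k)\<bar>)"
      using I(1) by (intro order_trans[OF abs_ge_zero Max_ge]) auto
    then show ?thesis by simp
  qed
  have "(\<Sum>j<m. b j) \<le> sqrt 2 / (sqrt 2 - 1) * sqrt Y"
    unfolding b_def using Y by (intro geometric_sum_below) auto
  also have "sqrt 2 / (sqrt 2 - 1) \<le> (4 :: real)"
  proof -
    have "4 / 3 \<le> sqrt (2 :: real)" by (rule real_le_rsqrt) (simp add: power2_eq_square)
    then show ?thesis by (simp add: field_simps)
  qed
  finally have b: "(\<Sum>j<m. b j) \<le> 4 * sqrt Y" using Y by (simp add: mult_right_mono)
  have c: "(\<Sum>j<m. c j) \<le> Z powr (- \<beta>) / (1 - 2 powr (- \<beta>))"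
    unfolding c_def using \<beta> by (intro geometric_sum_tail) (auto simp: powr_less_one)
  have "(\<Sum>j<m. ennreal (?a j)) = ennreal (\<Sum>j<m. ?a j)"
    by (rule sum_ennreal) (rule a_nn)
  also have "\<dots> \<le> ennreal (\<delta> * (\<Sum>j<m. b j) + L * (\<Sum>j<m. c j))"
    using a_le by (intro ennreal_leI) (auto simp: sum_distrib_left sum.distrib[symmetric] intro: sum_mono)
  also have "\<dots> \<le> ennreal (4 * sqrt Y * \<delta> + L * (Z powr (- \<beta>) / (1 - 2 powr (- \<beta>))))"
  proof (intro ennreal_leI add_mono)
    show "\<delta> * (\<Sum>j<m. b j) \<le> 4 * sqrt Y * \<delta>"
      using mult_left_mono[OF b \<delta>] by (simp add: mult_ac)
    show "L * (\<Sum>j<m. c j) \<le> L * (Z powr (- \<beta>) / (1 - 2 powr (- \<beta>)))"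
      by (rule mult_left_mono[OF c L])
  qed
  finally show "(\<Sum>j<m. ennreal (?a j)) \<le> ennreal (4 * sqrt Y * \<delta> + L * (Z powr (- \<beta>) / (1 - 2 powr (- \<beta>))))" .
qed simp

lemma cutoff_level_bounds:
  assumes "1 \<le> n"
  shows "2 ^ cutoff_level n \<le> real n" "real n < 2 ^ Suc (cutoff_level n)"
proof -
  let ?l = "ln (real n) / ln 2"
  have l: "0 \<le> ?l" using assms by simp
  have pow: "(2 :: real) ^ m = exp (real m * ln 2)" for m
    using powr_realpow[of 2 m] by (simp add: powr_def)
  have J: "real (cutoff_level n) \<le> ?l" "?l < real (Suc (cutoff_level n))"
    using l unfolding cutoff_level_def by linarith+
  have "real (cutoff_level n) * ln 2 \<le> ln (real n)" "ln (real n) < real (Suc (cutoff_level n)) * ln 2"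
    using J by (simp_all add: field_simps del: of_nat_Suc)
  then show "2 ^ cutoff_level n \<le> real n" "real n < 2 ^ Suc (cutoff_level n)"
    unfolding pow using assms exp_le_cancel_iff[of _ "ln (real n)"] exp_less_cancel_iff[of "ln (real n)"]
    by (simp_all del: exp_le_cancel_iff exp_less_cancel_iff of_nat_Suc)
qed

lemma ln_2_ge_half: "1 / 2 \<le> ln (2 :: real)"
  using ln2_ge_two_thirds by simp

text \<open>At resolution \<open>X\<close> the bias \<open>X\<^bsup>-\<beta>\<^esup>\<close> of a \<open>\<beta>\<close>-smooth signal matches \<open>X\<^bsup>1/2\<^esup>\<close> times the threshold
  \<open>\<surd>(log n / n)\<close>.\<close>

lemma contraction_scale:
  fixes n :: nat and \<beta> :: real
  assumes n: "2 \<le> n" and \<beta>: "0 < \<beta>"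
  defines "X \<equiv> (real n / ln (real n)) powr (1 / (2 * \<beta> + 1))"
  shows "1 \<le> X" "X \<le> 2 * real n" "X powr (- \<beta>) = (real n / ln (real n)) powr (- (\<beta> / (2 * \<beta> + 1)))"
    "X powr (- (\<beta> + 1 / 2)) = sqrt (ln (real n)) * real n powr (- 1/2)"
proof -
  let ?u = "real n / ln (real n)"
  have "ln 2 \<le> ln (real n)" using n by (intro ln_mono) auto
  then have ln: "1 / 2 \<le> ln (real n)" using ln_2_ge_half by linarith
  have lnn: "ln (real n) \<le> real n" using n ln_le_minus_one[of "real n"] by simp
  have u1: "1 \<le> ?u" using ln lnn n by (simp add: le_divide_eq)
  have u2: "?u \<le> 2 * real n" using ln n mult_left_mono[of 1 "2 * ln (real n)" "real n"] by (simp add: divide_le_eq mult_ac)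
  show "1 \<le> X" unfolding X_def using u1 \<beta> by (intro ge_one_powr_ge_zero) auto
  have "X \<le> ?u powr 1" unfolding X_def using u1 \<beta> by (intro powr_mono) auto
  then show "X \<le> 2 * real n" using u1 u2 by simp
  show "X powr (- \<beta>) = ?u powr (- (\<beta> / (2 * \<beta> + 1)))"
    unfolding X_def by (simp add: powr_powr)
  have e: "1 / (2 * \<beta> + 1) * (- (\<beta> + 1 / 2)) = - 1 / 2" using \<beta> by (simp add: field_simps)
  have "X powr (- (\<beta> + 1 / 2)) = ?u powr (- 1 / 2)"
    unfolding X_def powr_powr e ..
  also have "\<dots> = (ln (real n) powr (1/2)) * real n powr (- 1/2)"
    using n ln by (simp add: powr_divide powr_minus field_simps)
  finally show "X powr (- (\<beta> + 1 / 2)) = sqrt (ln (real n)) * real n powr (- 1/2)"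
    using ln by (simp add: powr_half_sqrt)
qed

lemma exp_times_ln: "0 < n \<Longrightarrow> exp (c * ln (real n)) = real n powr c"
  by (simp add: powr_def)

text \<open>The choice of \<open>x\<close> turns \<open>exp (- x\<^sup>2 / 4)\<close> into \<open>n\<^bsup>-A\<^esup>\<close>.\<close>

lemma posterior_far_bound_numeric:
  fixes n :: nat
  assumes n: "2 \<le> n" and A: "1 \<le> A" and K: "0 < K" and c: "0 < c" and w: "real n powr (- K) \<le> w"
    and x: "x = 2 * sqrt (A * ln (real n))"
  shows "sqrt 2 * exp (- x\<^sup>2 / 4) + exp (- 5 * x\<^sup>2 / 2) / (2 * w * c * real n powr (- 1/2)) \<le>
    (sqrt 2 + 1 / (2 * c)) * real n powr (K + 1/2 - A)"
proof -
  have n0: "0 < n" using n by simp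
  have ln: "0 \<le> ln (real n)" using n by simp
  have x2: "x\<^sup>2 = 4 * (A * ln (real n))" using x ln A by (simp add: power_mult_distrib)
  have e1: "exp (- x\<^sup>2 / 4) = real n powr (- A)" unfolding x2 using exp_times_ln[OF n0, of "- A"] by simp
  have e2: "exp (- 5 * x\<^sup>2 / 2) = real n powr (- 10 * A)" unfolding x2 using exp_times_ln[OF n0, of "- 10 * A"] by (simp add: mult.assoc)
  have "0 < real n powr (- K)" using n by simp
  then have w0: "0 < w" using w by linarith
  have "exp (- 5 * x\<^sup>2 / 2) / (2 * w * c * real n powr (- 1/2)) \<le>
      real n powr (- 10 * A) / (2 * real n powr (- K) * c * real n powr (- 1/2))"
    unfolding e2 using w w0 c n by (intro divide_left_mono mult_mono mult_pos_pos mult_nonneg_nonneg) auto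
  also have "\<dots> = 1 / (2 * c) * (real n powr (- 10 * A) * real n powr K * real n powr (1/2))"
    using n c by (simp add: powr_minus field_simps)
  also have "real n powr (- 10 * A) * real n powr K * real n powr (1/2) = real n powr (- 10 * A + K + 1/2)"
    by (simp only: powr_add)
  also have "1 / (2 * c) * \<dots> \<le> 1 / (2 * c) * real n powr (K + 1/2 - A)"
    using n A c by (intro mult_left_mono powr_mono) auto
  finally have 2: "exp (- 5 * x\<^sup>2 / 2) / (2 * w * c * real n powr (- 1/2)) \<le> 1 / (2 * c) * real n powr (K + 1/2 - A)" .
  have "real n powr (- A) \<le> real n powr (K + 1/2 - A)" using n K by (intro powr_mono) auto
  then have 1: "sqrt 2 * exp (- x\<^sup>2 / 4) \<le> sqrt 2 * real n powr (K + 1/2 - A)"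
    unfolding e1 by (intro mult_left_mono) auto
  show ?thesis using add_mono[OF 1 2] by (simp only: distrib_right)
qed

text \<open>Here \<open>n\<^bsup>-1/2\<^esup>\<close> loses a factor \<open>n\<^bsup>1/8\<^esup>\<close> to the likelihood ratio, which the assumption on \<open>s\<close>
  guarantees, and another one to \<open>x\<close>, which is logarithmic.\<close>

lemma posterior_slab_bound_numeric:
  fixes n :: nat
  assumes n: "2 \<le> n" and A: "0 \<le> A" and w: "0 \<le> w" and G: "0 \<le> G"
    and x: "x = 2 * sqrt (A * ln (real n))" and h: "h = s * sqrt (ln (real n))"
    and s: "s\<^sup>2 / 2 + 2 * s * sqrt A \<le> 1 / 8"
  shows "sqrt 2 * exp (- x\<^sup>2 / 4) + 4 * w * G * x * real n powr (- 1/2) * exp (h\<^sup>2 / 2 + h * x) \<le>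
    sqrt 2 * real n powr (- A) + 16 * G * sqrt A * w * real n powr (- 1/4)"
proof -
  have n0: "0 < n" using n by simp
  have ln: "0 \<le> ln (real n)" using n by simp
  have x2: "x\<^sup>2 = 4 * (A * ln (real n))" using x ln A by (simp add: power_mult_distrib)
  have e1: "exp (- x\<^sup>2 / 4) = real n powr (- A)" unfolding x2 using exp_times_ln[OF n0, of "- A"] by simp
  have "h\<^sup>2 / 2 + h * x = (s\<^sup>2 / 2 + 2 * s * sqrt A) * ln (real n)"
    using ln by (simp add: h x power_mult_distrib real_sqrt_mult algebra_simps)
  also have "\<dots> \<le> 1 / 8 * ln (real n)" by (rule mult_right_mono[OF s ln])
  finally have e: "exp (h\<^sup>2 / 2 + h * x) \<le> real n powr (1 / 8)"
    using exp_times_ln[OF n0, of "1/8"] by (metis exp_le_cancel_iff)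
  have "ln (real n) = 4 * ln (real n powr (1/4))" using n by (simp add: ln_powr)
  also have "\<dots> \<le> 4 * real n powr (1/4)"
    using n ln_le_minus_one[of "real n powr (1/4)"] by simp
  finally have "sqrt (ln (real n)) \<le> sqrt (4 * real n powr (1/4))" by (rule real_sqrt_le_mono)
  also have "\<dots> = 2 * real n powr (1/8)"
    by (simp add: real_sqrt_mult powr_half_sqrt[symmetric] powr_powr)
  finally have "x \<le> 2 * (sqrt A * (2 * real n powr (1/8)))"
    unfolding x real_sqrt_mult using A by (intro mult_left_mono) auto
  then have x': "x \<le> 4 * sqrt A * real n powr (1/8)" by simp
  have x0: "0 \<le> x" using x ln A by simp
  have "4 * w * G * x * real n powr (- 1/2) * exp (h\<^sup>2 / 2 + h * x) \<le>
      4 * w * G * (4 * sqrt A * real n powr (1/8)) * real n powr (- 1/2) * real n powr (1 / 8)"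
    using w G x' x0 e A by (intro mult_mono mult_nonneg_nonneg order_refl) auto
  also have "\<dots> = 16 * G * sqrt A * w * (real n powr (1/8) * real n powr (- 1/2) * real n powr (1/8))"
    by simp
  also have "real n powr (1/8) * real n powr (- 1/2) * real n powr (1/8) = real n powr (- 1/4)"
    by (simp flip: powr_add)
  finally show ?thesis unfolding e1 by simp
qed

text \<open>Level \<open>j\<close> has about \<open>2\<^sup>j\<close> coordinates. The constant \<open>a\<close> is therefore counted of order \<open>n\<close> times in total,
  while \<open>2\<^sup>j 2\<^bsup>-3j/2\<^esup> = 2\<^bsup>-j/2\<^esup>\<close> sums to a multiple of \<open>1 / D\<close> over the levels with
  \<open>D\<^sup>2 < 2\<^sup>j\<close>.\<close>

lemma level_sum_bounds:
  fixes I :: "nat \<Rightarrow> 'k set"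
  assumes I: "\<And>j. finite (I j)" "\<And>j. real (card (I j)) \<le> C * 2 ^ j" and C: "0 \<le> C"
    and n: "1 \<le> n" and a: "0 \<le> a" and b: "0 \<le> b" and D: "1 \<le> D"
  shows "(\<Sum>(j, k)\<in>Sigma {..cutoff_level n} I. a + (if D\<^sup>2 < 2 ^ j then b * 2 powr (- (3 * real j / 2)) else 0)) \<le>
    2 * C * real n * a + 4 * C * b / D"
proof -
  let ?J = "cutoff_level n"
  define r where "r = 1 / sqrt (2 :: real)"
  have r: "0 < r" "r < 1" by (auto simp: r_def)
  define t where "t = (\<lambda>j::nat. if D\<^sup>2 < 2 ^ j then b * 2 powr (- (3 * real j / 2)) else 0)"
  have t0: "0 \<le> t j" for j using b by (simp add: t_def)
  have t: "2 ^ j * t j \<le> b * (if r ^ j \<le> 1 / D then r ^ j else 0)" for j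
  proof (cases "D\<^sup>2 < 2 ^ j")
    case True
    have rj: "r ^ j = 1 / sqrt (2 ^ j)" by (simp add: r_def power_divide real_sqrt_power)
    have "D \<le> sqrt (2 ^ j)" using True D by (intro real_le_rsqrt) auto
    then have le: "r ^ j \<le> 1 / D" unfolding rj using D by (intro divide_left_mono) auto
    have "(2 ^ j :: real) * 2 powr (- (3 * real j / 2)) = 2 powr (real j + - (3 * real j / 2))"
      by (subst powr_add) (simp add: powr_realpow)
    also have "\<dots> = 2 powr (- (real j / 2))" by simp
    also have "\<dots> = (2 powr (- 1 / 2)) ^ j"
      by (simp add: powr_realpow[symmetric] powr_powr)
    also have "2 powr (- 1 / 2) = r"
      unfolding r_def using powr_minus_divide[of 2 "1 / 2 :: real"] by (simp add: powr_half_sqrt)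
    finally have "2 ^ j * 2 powr (- (3 * real j / 2)) = r ^ j" .
    then show ?thesis using True le by (simp add: t_def mult.left_commute[of _ b])
  next
    case False
    then show ?thesis using b r by (simp add: t_def)
  qed
  have "(\<Sum>(j, k)\<in>Sigma {..?J} I. a + t j) = (\<Sum>j\<le>?J. \<Sum>k\<in>I j. a + t j)"
    using I by (intro sum.Sigma[symmetric]) auto
  also have "\<dots> = (\<Sum>j\<le>?J. real (card (I j)) * (a + t j))" by simp
  also have "\<dots> \<le> (\<Sum>j\<le>?J. (C * 2 ^ j) * (a + t j))"
    using I a t0 by (intro sum_mono mult_right_mono) auto
  also have "\<dots> = C * a * (\<Sum>j\<le>?J. 2 ^ j) + C * (\<Sum>j\<le>?J. 2 ^ j * t j)"
    by (simp add: sum_distrib_left sum.distrib[symmetric] algebra_simps)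
  also have "\<dots> \<le> C * a * (2 * real n) + C * (b * (4 / D))"
  proof (intro add_mono mult_left_mono)
    have "(\<Sum>j\<le>?J. 2 ^ j) = (2 :: real) ^ Suc ?J - 1"
      using geometric_sum[of "2 :: real" "Suc ?J"] by (simp add: lessThan_Suc_atMost)
    also have "(2 :: real) ^ Suc ?J = 2 * 2 ^ ?J" by simp
    finally show "(\<Sum>j\<le>?J. 2 ^ j) \<le> 2 * real n" using cutoff_level_bounds(1)[OF n] by linarith
    have "(\<Sum>j\<le>?J. 2 ^ j * t j) \<le> (\<Sum>j\<le>?J. b * (if r ^ j \<le> 1 / D then r ^ j else 0))"
      by (intro sum_mono t)
    also have "\<dots> = b * (\<Sum>j<Suc ?J. if r ^ j \<le> 1 / D then r ^ j else 0)"
      by (simp only: sum_distrib_left lessThan_Suc_atMost)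
    also have "\<dots> \<le> b * ((1 / D) / (1 - r))"
      using r D by (intro mult_left_mono geometric_sum_tail b) auto
    also have "(1 / D) / (1 - r) \<le> (1 / D) / (1 / 4)"
    proof (intro divide_left_mono)
      have "4 / 3 \<le> sqrt (2 :: real)" by (rule real_le_rsqrt) (simp add: power2_eq_square)
      then have "r \<le> 1 / (4 / 3)" unfolding r_def by (intro divide_left_mono) auto
      then show "1 / 4 \<le> 1 - r" by simp
    qed (use D r in auto)
    finally show "(\<Sum>j\<le>?J. 2 ^ j * t j) \<le> b * (4 / D)" using b by (simp add: mult_left_mono)
  qed (use C a in auto)
  finally show ?thesis by (simp add: t_def mult_ac)
qed

section \<open>Contraction of the posterior\<close>

text \<open>The contraction bound with explicit constants, for one sample size, one posterior and one truth. The
  first summand bounds the far posterior mass on low levels and the noise tails on all levels; the second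
  is the posterior mass of nonzero coefficients on high levels. The exponent \<open>A\<close> makes the
  former small, the constant \<open>D\<close> the latter.\<close>

lemma spike_slab_contraction_fixed:
  fixes I :: "nat \<Rightarrow> 'k set" and C L\<^sub>0 K \<beta> L A D c G :: real and g :: "real \<Rightarrow> real" and w :: "nat \<Rightarrow> nat \<Rightarrow> real"
  assumes I: "\<And>j. finite (I j)" "\<And>j. I j \<noteq> {}" "\<And>j. real (card (I j)) \<le> C * 2 ^ j"
    and g: "g \<in> borel_measurable borel" "(\<integral>\<^sup>+x. ennreal (g x) \<partial>lborel) = 1"
    and G: "\<And>x. g x \<le> G" "0 \<le> G"
    and c: "0 < c" "\<And>x. x \<in> {-L\<^sub>0..L\<^sub>0} \<Longrightarrow> c \<le> g x"
    and K: "0 < K"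
    and w: "\<And>j. j \<le> cutoff_level n \<Longrightarrow> real n powr (- K) \<le> w j n"
      "\<And>j. j \<le> cutoff_level n \<Longrightarrow> w j n \<le> 2 powr (- (3 * real j / 2))"
    and L: "0 < L" "L \<le> L\<^sub>0 - 1" and \<beta>: "0 < \<beta>" and n: "2 \<le> n"
    and A: "1 \<le> A" and D: "1 \<le> D" and AD: "(L / D)\<^sup>2 / 2 + 2 * (L / D) * sqrt A \<le> 1 / 8"
    and M: "32 * sqrt A * D + L * (2 powr \<beta> / (1 - 2 powr (- \<beta>))) < M"
    and Q: "is_posterior (spike_slab_prior I g w n) (observation_space (wavelet_index I))
      (white_noise_model (wavelet_index I) n) Q"
    and \<theta>\<^sub>0: "\<theta>\<^sub>0 \<in> holder_ball I \<beta> L"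
  shows "(\<integral>\<^sup>+y. emeasure (Q y)
              {\<theta> \<in> ell2 (wavelet_index I).
                 loss_inf I \<theta> \<theta>\<^sub>0 \<ge> ennreal (M * (real n / ln (real n)) powr (- (\<beta> / (2 * \<beta> + 1))))}
         \<partial>white_noise_model (wavelet_index I) n \<theta>\<^sub>0) \<le>
    ennreal (2 * C * real n * ((sqrt 2 + 1 / (2 * c)) * real n powr (K + 1/2 - A))
      + 4 * C * (16 * G * sqrt A * real n powr (- 1/4)) / D)"
proof -
  define \<Lambda> where "\<Lambda> = wavelet_index I"
  define \<sigma> where "\<sigma> = real n powr (- 1/2)"
  define x where "x = 2 * sqrt (A * ln (real n))"
  define X where "X = (real n / ln (real n)) powr (1 / (2 * \<beta> + 1))"
  define J where "J = cutoff_level n"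
  \<comment> \<open>The low levels.\<close>
  define E where "E = {j. j \<le> J \<and> 2 ^ j \<le> D\<^sup>2 * X}"
  define \<mu> where "\<mu> = (\<lambda>(j::nat, k::'k). if j \<le> cutoff_level n then spike_slab_law g (w j n) else return borel 0)"
  define F where "F = Sigma {..J} I"
  \<comment> \<open>The bad values of a coefficient: far from the truth on low levels, nonzero on all others.\<close>
  define S where "S = (\<lambda>(j, k). if j \<in> E then {t. 4 * x * \<sigma> < \<bar>t - \<theta>\<^sub>0 (j, k)\<bar>} else - {0 :: real})"
  define T where "T = {\<theta> \<in> ell2 (wavelet_index I).
                 loss_inf I \<theta> \<theta>\<^sub>0 \<ge> ennreal (M * (real n / ln (real n)) powr (- (\<beta> / (2 * \<beta> + 1))))}"
  define lo where "lo = (sqrt 2 + 1 / (2 * c)) * real n powr (K + 1/2 - A)"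
  define hi where "hi = 16 * G * sqrt A * real n powr (- 1/4)"
  note scale = contraction_scale[OF n \<beta>, folded X_def]
  have n1: "1 \<le> n" using n by simp
  have \<sigma>: "0 < \<sigma>" "\<sigma> \<le> 1"
    using n powr_mono[of "- 1/2" 0 "real n"] by (auto simp: \<sigma>_def)
  have ln: "1 / 2 \<le> ln (real n)"
  proof -
    have "ln 2 \<le> ln (real n)" using n by (intro ln_mono) auto
    then show ?thesis using ln_2_ge_half by linarith
  qed
  have x: "1 \<le> x"
  proof -
    have "1 / 2 \<le> A * ln (real n)" using mult_mono[OF A ln] ln A by simp
    then have "sqrt ((1 / 2)\<^sup>2) \<le> sqrt (A * ln (real n))" by (intro real_sqrt_le_mono) (simp add: power2_eq_square)
    then show ?thesis by (simp add: x_def)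
  qed
  have countable: "countable \<Lambda>"
    unfolding \<Lambda>_def wavelet_index_def using I(1) by (intro countable_SIGMA) (auto intro: countable_finite)
  have D2: "1 \<le> D\<^sup>2" using D by (simp add: one_le_power)
  have w01: "0 < w j n" "w j n \<le> 1" if "j \<le> J" for j
  proof -
    have "0 < real n powr (- K)" using n by simp
    also have "\<dots> \<le> w j n" using w(1) that by (simp add: J_def)
    finally show "0 < w j n" .
    have "w j n \<le> 2 powr (- (3 * real j / 2))" using w(2) that by (simp add: J_def)
    also have "\<dots> \<le> 2 powr 0" by (intro powr_mono) auto
    finally show "w j n \<le> 1" by simp
  qed
  have \<mu>: "prob_space (\<mu> i)" "sets (\<mu> i) = sets borel" for i
  proof -
    obtain j k where i: "i = (j, k)" by (cases i)
    have "prob_space (return borel (0 :: real))" by (rule prob_space_return) simp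
    moreover have "prob_space (spike_slab_law g (w j n))" if "j \<le> J"
      using w01[OF that] by (intro prob_space_spike_slab_law g) auto
    ultimately show "prob_space (\<mu> i)" by (auto simp: i \<mu>_def J_def)
    show "sets (\<mu> i) = sets borel" by (simp add: i \<mu>_def)
  qed
  have \<theta>\<^sub>0_ell2: "\<theta>\<^sub>0 \<in> ell2 \<Lambda>" using \<theta>\<^sub>0 by (simp add: holder_ball_def \<Lambda>_def)
  have \<theta>\<^sub>0_le: "\<bar>\<theta>\<^sub>0 (j, k)\<bar> \<le> L * 2 powr (- (real j * (\<beta> + 1/2)))" if "k \<in> I j" for j k
    using \<theta>\<^sub>0 that by (simp add: holder_ball_def)
  have prior: "spike_slab_prior I g w n = restrict_space (PiM \<Lambda> \<mu>) (ell2 \<Lambda>)"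
    unfolding spike_slab_prior_def \<Lambda>_def \<mu>_def ..
  have S_sets: "S i \<in> sets borel" for i
    unfolding S_def by (cases i) (auto simp: split_beta)
  have rate: "4 * x * \<sigma> = 8 * sqrt A * X powr (- (\<beta> + 1/2))"
    unfolding scale(4) by (simp add: x_def \<sigma>_def real_sqrt_mult)
  have T_sub: "T \<subseteq> (\<Union>i\<in>\<Lambda>. {\<theta> \<in> ell2 \<Lambda>. \<theta> i \<in> S i})"
  proof
    fix \<theta> assume \<theta>: "\<theta> \<in> T"
    show "\<theta> \<in> (\<Union>i\<in>\<Lambda>. {\<theta> \<in> ell2 \<Lambda>. \<theta> i \<in> S i})"
    proof (rule ccontr)
      assume "\<not> ?thesis"
      then have out: "\<theta> (j, k) \<notin> S (j, k)" if "k \<in> I j" for j k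
        using \<theta> that by (auto simp: T_def \<Lambda>_def wavelet_index_def)
      have "loss_inf I \<theta> \<theta>\<^sub>0 \<le> ennreal (4 * sqrt (D\<^sup>2 * X) * (4 * x * \<sigma>) + L * ((X / 2) powr (- \<beta>) / (1 - 2 powr (- \<beta>))))"
      proof (rule loss_inf_le[where E=E])
        show "\<bar>\<theta> (j, k) - \<theta>\<^sub>0 (j, k)\<bar> \<le> 4 * x * \<sigma>" if "j \<in> E" "k \<in> I j" for j k
          using out[OF that(2)] that by (simp add: S_def not_less)
        show "\<theta> (j, k) = 0" if "j \<notin> E" "k \<in> I j" for j k
          using out[OF that(2)] that by (simp add: S_def)
        show "X / 2 \<le> 2 ^ j" if "j \<notin> E" for j
        proof (cases "j \<le> J")
          case True
          then have "D\<^sup>2 * X < 2 ^ j" using that by (simp add: E_def)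
          moreover have "1 * X \<le> D\<^sup>2 * X" using D2 scale(1) by (intro mult_right_mono) auto
          ultimately show ?thesis using scale(1) by linarith
        next
          case False
          then have "(2 :: real) ^ Suc J \<le> 2 ^ j" by (intro power_increasing) auto
          then show ?thesis using cutoff_level_bounds(2)[OF n1] scale(2) by (simp only: J_def)
        qed
      qed (use I \<beta> L x \<sigma> D scale(1) \<theta>\<^sub>0_le in \<open>auto simp: E_def\<close>)
      also have "4 * sqrt (D\<^sup>2 * X) * (4 * x * \<sigma>) = 32 * sqrt A * D * X powr (- \<beta>)"
      proof -
        have "sqrt (D\<^sup>2 * X) = D * X powr (1/2)" using D scale(1) by (simp add: real_sqrt_mult powr_half_sqrt)
        moreover have "X powr (1/2) * X powr (- (\<beta> + 1/2)) = X powr (- \<beta>)" by (simp flip: powr_add)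
        ultimately show ?thesis unfolding rate by (simp add: mult_ac)
      qed
      also have "(X / 2) powr (- \<beta>) = 2 powr \<beta> * X powr (- \<beta>)"
        using scale(1) by (simp add: powr_divide powr_minus field_simps)
      also have "32 * sqrt A * D * X powr (- \<beta>) + L * (2 powr \<beta> * X powr (- \<beta>) / (1 - 2 powr (- \<beta>))) =
          (32 * sqrt A * D + L * (2 powr \<beta> / (1 - 2 powr (- \<beta>)))) * X powr (- \<beta>)"
        by (simp add: distrib_right)
      also have "ennreal \<dots> < ennreal (M * X powr (- \<beta>))"
      proof (rule ennreal_lessI)
        have Xp: "0 < X powr (- \<beta>)" using scale(1) by simp
        show "(32 * sqrt A * D + L * (2 powr \<beta> / (1 - 2 powr (- \<beta>)))) * X powr (- \<beta>) < M * X powr (- \<beta>)"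
          by (rule mult_strict_right_mono[OF M Xp])
        have "2 powr (- \<beta>) \<le> 2 powr 0" using \<beta> by (intro powr_mono) auto
        then have "0 \<le> 32 * sqrt A * D + L * (2 powr \<beta> / (1 - 2 powr (- \<beta>)))"
          using A D L \<beta> by (intro add_nonneg_nonneg mult_nonneg_nonneg divide_nonneg_nonneg) auto
        then show "0 < M * X powr (- \<beta>)" using M Xp by (intro mult_pos_pos) auto
      qed
      finally show False using \<theta> by (simp add: T_def scale(3) not_le[symmetric])
    qed
  qed
  have "(\<integral>\<^sup>+y. emeasure (Q y) T \<partial>white_noise_model \<Lambda> n \<theta>\<^sub>0) \<le>
      (\<Sum>i\<in>F. \<integral>\<^sup>+y. normal_posterior (\<mu> i) \<sigma> (S i) y \<partial>normal_law (\<theta>\<^sub>0 i) \<sigma>)"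
    unfolding \<sigma>_def
  proof (rule posterior_union_bound[OF countable n1 \<mu> _ _ _ _ _ _ \<theta>\<^sub>0_ell2 T_sub])
    show "finite F" "F \<subseteq> \<Lambda>" using I(1) by (auto simp: F_def \<Lambda>_def wavelet_index_def)
    show "\<mu> i = return borel 0" if "i \<in> \<Lambda> - F" for i
      using that by (auto simp: F_def \<Lambda>_def wavelet_index_def \<mu>_def J_def split: if_splits)
    show "is_posterior (restrict_space (PiM \<Lambda> \<mu>) (ell2 \<Lambda>)) (observation_space \<Lambda>) (white_noise_model \<Lambda> n) Q"
      using Q unfolding prior \<Lambda>_def[symmetric] .
    show "S i \<in> sets borel" for i by (rule S_sets)
    show "0 \<notin> S i" if "i \<in> \<Lambda> - F" for i
      using that by (auto simp: F_def \<Lambda>_def wavelet_index_def S_def E_def split: if_splits)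
  qed
  also have "\<dots> \<le> (\<Sum>(j, k)\<in>F. ennreal (lo + (if D\<^sup>2 < 2 ^ j then hi * 2 powr (- (3 * real j / 2)) else 0)))"
  proof (intro sum_mono, clarify)
    fix j k assume "(j, k) \<in> F"
    then have jJ: "j \<le> J" and k: "k \<in> I j" by (auto simp: F_def)
    have \<mu>j: "\<mu> (j, k) = spike_slab_law g (w j n)" using jJ by (simp add: \<mu>_def J_def)
    have hi0: "0 \<le> hi" using G A by (simp add: hi_def)
    show "(\<integral>\<^sup>+y. normal_posterior (\<mu> (j, k)) \<sigma> (S (j, k)) y \<partial>normal_law (\<theta>\<^sub>0 (j, k)) \<sigma>)
        \<le> ennreal (lo + (if D\<^sup>2 < 2 ^ j then hi * 2 powr (- (3 * real j / 2)) else 0))"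
    proof (cases "j \<in> E")
      case True
      have "\<bar>\<theta>\<^sub>0 (j, k)\<bar> \<le> L * 2 powr (- (real j * (\<beta> + 1/2)))" by (rule \<theta>\<^sub>0_le[OF k])
      also have "\<dots> \<le> L * 2 powr 0" using L \<beta> by (intro mult_left_mono powr_mono) auto
      finally have \<theta>\<^sub>0L: "\<bar>\<theta>\<^sub>0 (j, k)\<bar> \<le> L" by simp
      have S_eq: "S (j, k) = {t. 4 * x * \<sigma> < \<bar>t - \<theta>\<^sub>0 (j, k)\<bar>}" using True by (simp add: S_def)
      have "(\<integral>\<^sup>+y. normal_posterior (\<mu> (j, k)) \<sigma> (S (j, k)) y \<partial>normal_law (\<theta>\<^sub>0 (j, k)) \<sigma>)
        \<le> ennreal (sqrt 2 * exp (- x\<^sup>2 / 4) + exp (- 5 * x\<^sup>2 / 2) / (2 * w j n * c * \<sigma>))"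
        unfolding \<mu>j S_eq
      proof (rule posterior_far_from_truth[OF g \<sigma>(1) w01[OF jJ] c(1) _ x])
        fix t assume "t \<in> {\<theta>\<^sub>0 (j, k) - \<sigma>..\<theta>\<^sub>0 (j, k) + \<sigma>}"
        then show "c \<le> g t" using \<theta>\<^sub>0L L \<sigma> by (intro c(2)) auto
      qed
      also have "\<dots> \<le> ennreal lo"
        unfolding \<sigma>_def lo_def using w(1) jJ
        by (intro ennreal_leI posterior_far_bound_numeric[OF n A K c(1) _ x_def]) (simp add: J_def)
      also have "\<dots> \<le> ennreal (lo + (if D\<^sup>2 < 2 ^ j then hi * 2 powr (- (3 * real j / 2)) else 0))"
        using hi0 by (intro ennreal_leI) auto
      finally show ?thesis .
    next
      case False
      then have high: "D\<^sup>2 * X < 2 ^ j" using jJ by (simp add: E_def)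
      have "D\<^sup>2 * 1 \<le> D\<^sup>2 * X" using scale(1) by (intro mult_left_mono) auto
      then have D2j: "D\<^sup>2 < 2 ^ j" using high by linarith
      have j1: "1 \<le> j"
      proof (rule ccontr)
        assume "\<not> 1 \<le> j"
        then have "j = 0" by simp
        then show False using D2j D2 by simp
      qed
      have w_half: "w j n \<le> 1 / 2"
      proof -
        have "w j n \<le> 2 powr (- (3 * real j / 2))" using w(2) jJ by (simp add: J_def)
        also have "\<dots> \<le> 2 powr (- 1)" using j1 by (intro powr_mono) auto
        finally show ?thesis by (simp add: powr_minus)
      qed
      have S_eq: "S (j, k) = - {0}" using False by (simp add: S_def)
      define h where "h = (L / D) * sqrt (ln (real n))"
      have small: "\<bar>\<theta>\<^sub>0 (j, k)\<bar> \<le> h * \<sigma>"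
      proof -
        have "\<bar>\<theta>\<^sub>0 (j, k)\<bar> \<le> L * 2 powr (- (real j * (\<beta> + 1/2)))" by (rule \<theta>\<^sub>0_le[OF k])
        also have "2 powr (- (real j * (\<beta> + 1/2))) = (2 ^ j) powr (- (\<beta> + 1/2))"
          by (simp add: powr_realpow[symmetric] powr_powr algebra_simps)
        also have "\<dots> \<le> (D\<^sup>2 * X) powr (- (\<beta> + 1/2))"
          using high \<beta> D scale(1) by (intro powr_mono2' mult_pos_pos) auto
        also have "\<dots> = (D\<^sup>2) powr (- (\<beta> + 1/2)) * X powr (- (\<beta> + 1/2))"
          by (rule powr_mult)
        also have "\<dots> \<le> (D\<^sup>2) powr (- (1/2)) * X powr (- (\<beta> + 1/2))"
          using D2 \<beta> by (intro mult_right_mono powr_mono) auto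
        also have "(D\<^sup>2) powr (- (1/2)) = 1 / D"
        proof -
          have "(D\<^sup>2) powr (1/2) = sqrt (D\<^sup>2)" by (rule powr_half_sqrt) simp
          then show ?thesis using D powr_minus_divide[of "D\<^sup>2" "1/2"] by simp
        qed
        also have "L * (1 / D * X powr (- (\<beta> + 1/2))) = h * \<sigma>"
          unfolding scale(4) by (simp add: h_def \<sigma>_def)
        finally show ?thesis using L by (simp add: mult_left_mono)
      qed
      have "(\<integral>\<^sup>+y. normal_posterior (\<mu> (j, k)) \<sigma> (S (j, k)) y \<partial>normal_law (\<theta>\<^sub>0 (j, k)) \<sigma>)
        \<le> ennreal (sqrt 2 * exp (- x\<^sup>2 / 4) + 4 * w j n * G * x * \<sigma> * exp (h\<^sup>2 / 2 + h * x))"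
        unfolding \<mu>j S_eq using x w01[OF jJ]
        by (intro posterior_slab_small_signal[OF g G(1) \<sigma>(1) _ w_half G(2) small]) auto
      also have "\<dots> \<le> ennreal (sqrt 2 * real n powr (- A) + 16 * G * sqrt A * w j n * real n powr (- 1/4))"
        unfolding \<sigma>_def using A w01[OF jJ] G
        by (intro ennreal_leI posterior_slab_bound_numeric[OF n _ _ _ x_def h_def AD]) auto
      also have "\<dots> \<le> ennreal (lo + hi * 2 powr (- (3 * real j / 2)))"
      proof (intro ennreal_leI add_mono)
        show "sqrt 2 * real n powr (- A) \<le> lo"
          unfolding lo_def using n K c by (intro mult_mono powr_mono) auto
        have "16 * G * sqrt A * w j n * real n powr (- 1/4) = hi * w j n" by (simp add: hi_def)
        also have "\<dots> \<le> hi * 2 powr (- (3 * real j / 2))"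
          using w(2) jJ hi0 by (intro mult_left_mono) (auto simp: J_def)
        finally show "16 * G * sqrt A * w j n * real n powr (- 1/4) \<le> hi * 2 powr (- (3 * real j / 2))" .
      qed
      finally show ?thesis using D2j by simp
    qed
  qed
  also have "\<dots> = ennreal (\<Sum>(j, k)\<in>F. lo + (if D\<^sup>2 < 2 ^ j then hi * 2 powr (- (3 * real j / 2)) else 0))"
  proof -
    have "0 \<le> lo" "0 \<le> hi" using c G A by (auto simp: lo_def hi_def)
    then show ?thesis unfolding split_beta by (intro sum_ennreal) auto
  qed
  also have "\<dots> \<le> ennreal (2 * C * real n * lo + 4 * C * hi / D)"
  proof -
    have "0 \<le> C" using I(3)[of 0] by (metis mult.right_neutral of_nat_0_le_iff order_trans power_0)
    moreover have "0 \<le> lo" "0 \<le> hi" using c G A by (auto simp: lo_def hi_def)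
    ultimately show ?thesis
      unfolding F_def J_def using I n1 D by (intro ennreal_leI level_sum_bounds) auto
  qed
  finally show ?thesis unfolding T_def \<Lambda>_def lo_def hi_def .
qed

theorem theorem3p1:
  fixes I :: "nat \<Rightarrow> 'k set" and c\<^sub>1 c\<^sub>2 L\<^sub>0 K \<tau> \<beta>\<^sub>1 \<beta>\<^sub>2 L :: real
    and g :: "real \<Rightarrow> real" and w :: "nat \<Rightarrow> nat \<Rightarrow> real"
  assumes c: "0 < c\<^sub>1" "c\<^sub>1 \<le> c\<^sub>2"
    and I_finite: "\<And>j. finite (I j)"
    and I_card: "\<And>j. c\<^sub>1 * 2 ^ j \<le> real (card (I j)) \<and> real (card (I j)) \<le> c\<^sub>2 * 2 ^ j"
    and L\<^sub>0: "L\<^sub>0 > 0"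
    and g_measurable: "g \<in> borel_measurable borel"
    and g_nonneg: "\<And>x. 0 \<le> g x"
    and g_density: "(\<integral>\<^sup>+x. ennreal (g x) \<partial>lborel) = 1"
    and g_bounded: "bounded (range g)"
    and g_inf: "(INF x\<in>{-L\<^sub>0..L\<^sub>0}. g x) > 0"
    and K: "K > 0"
    and \<tau>: "\<tau> > 1/2"
    and w: "\<And>n j. 2 \<le> n \<Longrightarrow> j \<le> cutoff_level n \<Longrightarrow>
              real n powr (- K) \<le> w j n \<and> w j n \<le> 2 powr (- (real j * (1 + \<tau>)))"
    and \<beta>: "0 < \<beta>\<^sub>1" "\<beta>\<^sub>1 \<le> \<beta>\<^sub>2"
    and L: "0 < L" "L \<le> L\<^sub>0 - 1"
  shows "\<exists>M>0. \<exists>B>0. \<forall>\<beta>\<in>{\<beta>\<^sub>1..\<beta>\<^sub>2}. \<forall>n\<ge>2. \<forall>Q.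
    is_posterior (spike_slab_prior I g w n) (observation_space (wavelet_index I))
      (white_noise_model (wavelet_index I) n) Q \<longrightarrow>
    (SUP \<theta>\<^sub>0\<in>holder_ball I \<beta> L.
       \<integral>\<^sup>+y. emeasure (Q y)
              {\<theta> \<in> ell2 (wavelet_index I).
                 loss_inf I \<theta> \<theta>\<^sub>0 \<ge>
                   ennreal (M * (real n / ln (real n)) powr (- (\<beta> / (2 * \<beta> + 1))))}
         \<partial>white_noise_model (wavelet_index I) n \<theta>\<^sub>0)
    \<le> ennreal (real n powr (- B))"
proof -
  obtain G where abs_g: "\<bar>g x\<bar> \<le> G" for x using g_bounded by (auto simp: bounded_iff)
  have G: "g x \<le> G" "0 \<le> G" for x
    using abs_g order_trans[OF abs_ge_self] order_trans[OF abs_ge_zero] by blast+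
  define c where "c = (INF x\<in>{-L\<^sub>0..L\<^sub>0}. g x)"
  have c0: "0 < c" using g_inf by (simp add: c_def)
  have c_le: "c \<le> g x" if "x \<in> {-L\<^sub>0..L\<^sub>0}" for x
    unfolding c_def using that g_nonneg by (intro cINF_lower bdd_belowI[of _ 0]) auto
  have C: "0 < c\<^sub>2" using c by simp
  define c' where "c' = 2 * c\<^sub>2 * (sqrt 2 + 1 / (2 * c))"
  have c': "0 < c'" using C c0 by (simp add: c'_def add_pos_pos)
  \<comment> \<open>The surplus \<open>a\<close> in the exponent absorbs the constant \<open>c'\<close>, because \<open>n \<ge> 2\<close>.\<close>
  define a where "a = max 0 (log 2 (2 * c'))"
  have a: "0 \<le> a" "2 * c' \<le> 2 powr a"
  proof -
    show "0 \<le> a" by (simp add: a_def)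
    have "2 * c' = 2 powr (log 2 (2 * c'))" using c' by simp
    also have "\<dots> \<le> 2 powr a" by (intro powr_mono) (auto simp: a_def)
    finally show "2 * c' \<le> 2 powr a" .
  qed
  \<comment> \<open>The sum of \<open>K + 1/2\<close>, one unit for the number of coordinates, and the target exponent 1/8.\<close>
  define A where "A = K + 13/8 + a"
  have A: "1 \<le> A" using K a by (simp add: A_def)
  \<comment> \<open>Each summand serves one of the smallness conditions on \<open>1 / D\<close>.\<close>
  define D where "D = 1 + 8 * L\<^sup>2 + 32 * L * sqrt A + 128 * c\<^sub>2 * G * sqrt A"
  have D_parts: "0 \<le> 8 * L\<^sup>2" "0 \<le> 32 * L * sqrt A" "0 \<le> 128 * c\<^sub>2 * G * sqrt A"
    using L A C G by auto
  have D_ge: "8 * L\<^sup>2 \<le> D" "32 * L * sqrt A \<le> D" "128 * c\<^sub>2 * G * sqrt A \<le> D"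
    unfolding D_def using D_parts by linarith+
  have D: "1 \<le> D" unfolding D_def using D_parts by linarith
  then have D0: "0 < D" by simp
  have AD: "(L / D)\<^sup>2 / 2 + 2 * (L / D) * sqrt A \<le> 1 / 8"
  proof -
    have "L\<^sup>2 / D\<^sup>2 \<le> L\<^sup>2 / D" using D by (intro divide_left_mono) (auto simp: power2_eq_square)
    also have "\<dots> \<le> 1 / 8" using D_ge by (simp add: pos_divide_le_eq[OF D0])
    finally have 1: "(L / D)\<^sup>2 \<le> 1 / 8" unfolding power_divide .
    have "L * sqrt A / D \<le> 1 / 32" using D_ge by (simp add: pos_divide_le_eq[OF D0])
    moreover have "2 * (L / D) * sqrt A = 2 * (L * sqrt A / D)" by simp
    ultimately show ?thesis using 1 by linarith
  qed
  define M where "M = 32 * sqrt A * D + L * (2 powr \<beta>\<^sub>2 / (1 - 2 powr (- \<beta>\<^sub>1))) + 1"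
  have b1: "2 powr (- \<beta>\<^sub>1) < 1" using \<beta> powr_less_mono[of "- \<beta>\<^sub>1" 0 2] by simp
  have M: "0 < M"
    unfolding M_def using A D L b1 by (intro add_nonneg_pos add_nonneg_nonneg mult_nonneg_nonneg divide_nonneg_nonneg) auto
  have "(SUP \<theta>\<^sub>0\<in>holder_ball I \<beta> L.
       \<integral>\<^sup>+y. emeasure (Q y)
              {\<theta> \<in> ell2 (wavelet_index I).
                 loss_inf I \<theta> \<theta>\<^sub>0 \<ge>
                   ennreal (M * (real n / ln (real n)) powr (- (\<beta> / (2 * \<beta> + 1))))}
         \<partial>white_noise_model (wavelet_index I) n \<theta>\<^sub>0)
    \<le> ennreal (real n powr (- (1/8)))"
    if \<beta>': "\<beta> \<in> {\<beta>\<^sub>1..\<beta>\<^sub>2}" and n: "2 \<le> n"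
      and Q: "is_posterior (spike_slab_prior I g w n) (observation_space (wavelet_index I))
        (white_noise_model (wavelet_index I) n) Q" for \<beta> n Q
  proof (rule SUP_least)
    fix \<theta>\<^sub>0 assume \<theta>\<^sub>0: "\<theta>\<^sub>0 \<in> holder_ball I \<beta> L"
    have \<beta>0: "0 < \<beta>" using \<beta>' \<beta> by simp
    have "2 powr \<beta> / (1 - 2 powr (- \<beta>)) \<le> 2 powr \<beta>\<^sub>2 / (1 - 2 powr (- \<beta>\<^sub>1))"
    proof (rule frac_le)
      have "2 powr (- \<beta>) \<le> 2 powr (- \<beta>\<^sub>1)" using \<beta>' by (intro powr_mono) auto
      then show "1 - 2 powr (- \<beta>\<^sub>1) \<le> 1 - 2 powr (- \<beta>)" by simp
    qed (use \<beta>' b1 in auto)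
    then have "L * (2 powr \<beta> / (1 - 2 powr (- \<beta>))) \<le> L * (2 powr \<beta>\<^sub>2 / (1 - 2 powr (- \<beta>\<^sub>1)))"
      using L by (intro mult_left_mono) auto
    then have M': "32 * sqrt A * D + L * (2 powr \<beta> / (1 - 2 powr (- \<beta>))) < M"
      unfolding M_def by linarith
    have I_ne: "I j \<noteq> {}" for j
    proof
      assume "I j = {}"
      then have "c\<^sub>1 * 2 ^ j \<le> 0" using I_card[of j] by simp
      moreover have "0 < c\<^sub>1 * 2 ^ j" using c by simp
      ultimately show False by linarith
    qed
    have w': "w j n \<le> 2 powr (- (3 * real j / 2))" if "j \<le> cutoff_level n" for j
    proof -
      have "w j n \<le> 2 powr (- (real j * (1 + \<tau>)))" using w[OF n that] by simp
      also have "\<dots> \<le> 2 powr (- (3 * real j / 2))"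
        using \<tau> mult_left_mono[of "3/2" "1 + \<tau>" "real j"] by (intro powr_mono) auto
      finally show ?thesis .
    qed
    have main: "2 * c\<^sub>2 * real n * ((sqrt 2 + 1 / (2 * c)) * real n powr (K + 1/2 - A))
        + 4 * c\<^sub>2 * (16 * G * sqrt A * real n powr (- 1/4)) / D \<le> real n powr (- (1/8))"
    proof -
      have "2 * c\<^sub>2 * real n * ((sqrt 2 + 1 / (2 * c)) * real n powr (K + 1/2 - A)) =
          c' * (real n powr 1 * real n powr (K + 1/2 - A))"
        using n by (simp add: c'_def mult_ac)
      also have "real n powr 1 * real n powr (K + 1/2 - A) = real n powr (- a) * real n powr (- (1/8))"
        unfolding powr_add[symmetric] by (simp add: A_def algebra_simps)
      also have "c' * (real n powr (- a) * real n powr (- (1/8))) \<le> c' * (2 powr (- a) * real n powr (- (1/8)))"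
        using n a c' by (intro mult_left_mono mult_right_mono powr_mono2') auto
      also have "\<dots> = c' / 2 powr a * real n powr (- (1/8))" using powr_minus_divide[of 2 a] by simp
      also have "\<dots> \<le> 1 / 2 * real n powr (- (1/8))"
        using a by (intro mult_right_mono) (auto simp: divide_le_eq)
      finally have 1: "2 * c\<^sub>2 * real n * ((sqrt 2 + 1 / (2 * c)) * real n powr (K + 1/2 - A)) \<le> 1 / 2 * real n powr (- (1/8))" .
      have "4 * c\<^sub>2 * (16 * G * sqrt A * real n powr (- 1/4)) / D = (64 * c\<^sub>2 * G * sqrt A / D) * real n powr (- 1/4)"
        by simp
      also have "\<dots> \<le> 1 / 2 * real n powr (- (1/8))"
      proof (rule mult_mono)
        show "64 * c\<^sub>2 * G * sqrt A / D \<le> 1 / 2" using D_ge by (simp add: pos_divide_le_eq[OF D0])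
        show "real n powr (- 1/4) \<le> real n powr (- (1/8))" using n by (intro powr_mono) auto
      qed auto
      finally show ?thesis using 1 by simp
    qed
    show "(\<integral>\<^sup>+y. emeasure (Q y)
              {\<theta> \<in> ell2 (wavelet_index I).
                 loss_inf I \<theta> \<theta>\<^sub>0 \<ge>
                   ennreal (M * (real n / ln (real n)) powr (- (\<beta> / (2 * \<beta> + 1))))}
         \<partial>white_noise_model (wavelet_index I) n \<theta>\<^sub>0) \<le> ennreal (real n powr (- (1/8)))"
      using w[OF n] I_card c_le
      by (intro order_trans[OF spike_slab_contraction_fixed[OF I_finite I_ne _ g_measurable g_density G c0 _ K _ w' L \<beta>0 n A D AD M' Q \<theta>\<^sub>0] ennreal_leI[OF main]])
        auto
  qed
  then show ?thesis
    using M by (intro exI[of _ M] conjI exI[of _ "1/8"]) auto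
qed

end
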